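(* Suppose that (for all $n\ge1$) for any $t\in\mathbb{C}$ the subspace $\xi\mathbb{C}[\xi,z]:=\sum_{i=1}^n\xi_i\mathbb{C}[\xi,z]$ of $\mathcal{B}_t[\xi,z]$ is a Mathieu subspace of $\mathcal{B}_t[\xi,z]$. Then the Jacobian conjecture holds.
   Context: Let $\xi=(\xi_1,\dots,\xi_n)$ and $z=(z_1,\dots,z_n)$ be $2n$ commuting free variables, $\partial_i=\partial/\partial z_i$, $\delta_i=\partial/\partial\xi_i$. For $t\in\mathbb{C}$, $\mathcal{B}_t[\xi,z]$ is the vector space $\mathbb{C}[\xi,z]$ with the product $f\ast_t g:=\mu\big(e^{-t\Omega}(f\otimes g)\big)$, where $\Omega=\sum_{i=1}^n(\partial_i\otimes\delta_i+\delta_i\otimes\partial_i)$ and $\mu(f\otimes g)=fg$ is the usual multiplication; it is a commutative algebra. In $\xi_i\mathbb{C}[\xi,z]$ the product is the usual product of polynomials. Mathieu subspace: for a commutative ring $R$ and a commutative $R$-algebra $A$, an $R$-subspace $M\subseteq A$ is a Mathieu subspace of $A$ if whenever $a\in A$ satisfies $a^m\in M$ for all $m\ge1$, then for every $b\in A$ there is $N\ge1$ (depending on $a$ and $b$) such that $b\,a^m\in M$ for all $m\ge N$ (products and powers in $A$). The Jacobian conjecture: for every $n\ge1$, every polynomial map $F:\mathbb{C}^n\to\mathbb{C}^n$ whose Jacobian determinant is a nonzero constant has a polynomial inverse. *)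

theory Defs
  imports
    "HOL-Algebra.Module"
    "HOL-Library.Poly_Mapping"
    "HOL-Library.Groups_Big_Fun"
    "Jordan_Normal_Form.Determinant"
begin

section \<open>Multivariate polynomials over the complex numbers\<close>

text \<open>A polynomial is a finitely supported map from monomials to coefficients, and a monomial is a
  finitely supported map from variables to exponents.  The type \<open>'v\<close> may be infinite; a polynomial
  ring in finitely many variables is the subset \<open>mp_ring V\<close> of its type.\<close>

type_synonym 'v mp = "('v \<Rightarrow>\<^sub>0 nat) \<Rightarrow>\<^sub>0 complex"

definition mp_const :: "complex \<Rightarrow> 'v mp" where
  "mp_const c = Poly_Mapping.single 0 c"

definition mp_var :: "'v \<Rightarrow> 'v mp" where
  "mp_var x = Poly_Mapping.single (Poly_Mapping.single x 1) 1"

definition mp_ring :: "'v set \<Rightarrow> 'v mp set" where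
  "mp_ring V = {p. \<forall>m\<in>Poly_Mapping.keys p. Poly_Mapping.keys m \<subseteq> V}"

text \<open>Evaluation at \<open>v\<close> in a commutative ring, along the map \<open>h\<close> on coefficients.\<close>

definition mp_eval :: "(complex \<Rightarrow> 'b) \<Rightarrow> ('v \<Rightarrow> 'b) \<Rightarrow> 'v mp \<Rightarrow> 'b::comm_ring_1" where
  "mp_eval h v p = (\<Sum>m\<in>Poly_Mapping.keys p. h (Poly_Mapping.lookup p m) *
     (\<Prod>x\<in>Poly_Mapping.keys m. v x ^ Poly_Mapping.lookup m x))"

abbreviation mp_value :: "('v \<Rightarrow> complex) \<Rightarrow> 'v mp \<Rightarrow> complex" where
  "mp_value \<equiv> mp_eval (\<lambda>c. c)"

abbreviation mp_subst :: "('v \<Rightarrow> 'w mp) \<Rightarrow> 'v mp \<Rightarrow> 'w mp" where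
  "mp_subst \<equiv> mp_eval mp_const"

text \<open>The subtraction of exponents is truncated, but where it truncates the coefficient is zero.\<close>

definition mp_deriv :: "'v \<Rightarrow> 'v mp \<Rightarrow> 'v mp" where
  "mp_deriv x p = (\<Sum>m\<in>Poly_Mapping.keys p.
     Poly_Mapping.single (m - Poly_Mapping.single x 1)
       (of_nat (Poly_Mapping.lookup m x) * Poly_Mapping.lookup p m))"


section \<open>Mathieu subspaces\<close>

text \<open>Meant for a commutative ring \<open>R\<close> and a commutative \<open>R\<close>-algebra \<open>A\<close> (locale \<open>algebra R A\<close>);
  products and powers are those of \<open>A\<close>, and \<open>R\<close>-subspaces are submodules.\<close>

definition mathieu_subspace ::
    "('r, 'x) ring_scheme \<Rightarrow> ('r, 'a, 'y) module_scheme \<Rightarrow> 'a set \<Rightarrow> bool" where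
  "mathieu_subspace R A M \<longleftrightarrow> submodule M R A \<and>
     (\<forall>a\<in>carrier A. (\<forall>m\<ge>1::nat. a [^]\<^bsub>A\<^esub> m \<in> M) \<longrightarrow>
        (\<forall>b\<in>carrier A. \<exists>N\<ge>1::nat. \<forall>m\<ge>N. b \<otimes>\<^bsub>A\<^esub> a [^]\<^bsub>A\<^esub> m \<in> M))"


section \<open>The algebras B_t\<close>

text \<open>\<open>Xi i\<close> and \<open>Zv i\<close> for \<open>i < n\<close> are the \<open>2n\<close> variables, indexed from 0.\<close>

datatype xz = Xi nat | Zv nat

definition xz_ring :: "nat \<Rightarrow> xz mp set" where
  "xz_ring n = mp_ring (Xi ` {..<n} \<union> Zv ` {..<n})"

text \<open>The tensor square of a polynomial ring is the polynomial ring in two copies \<open>Inl x\<close>, \<open>Inr x\<close>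
  of its variables: the left copy carries the left tensor factor.  In these terms an operator
  \<open>D \<otimes> E\<close> is \<open>D\<close> in the left variables composed with \<open>E\<close> in the right variables, and the
  multiplication map identifies the two copies.\<close>

definition mp_tensor :: "'v mp \<Rightarrow> 'v mp \<Rightarrow> ('v + 'v) mp" where
  "mp_tensor f g = mp_subst (\<lambda>x. mp_var (Inl x)) f * mp_subst (\<lambda>x. mp_var (Inr x)) g"

definition mp_mu :: "('v + 'v) mp \<Rightarrow> 'v mp" where
  "mp_mu = mp_subst (case_sum mp_var mp_var)"

definition Omega :: "nat \<Rightarrow> (xz + xz) mp \<Rightarrow> (xz + xz) mp" where
  "Omega n F = (\<Sum>i<n. mp_deriv (Inl (Zv i)) (mp_deriv (Inr (Xi i)) F)
                      + mp_deriv (Inl (Xi i)) (mp_deriv (Inr (Zv i)) F))"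

text \<open>The exponential series of \<open>-t\<Omega>\<close>.  \<open>Sum_any\<close> sums the nonzero terms; there are finitely many
  of them by \<open>finite_exp_Omega\<close> below.\<close>

definition exp_Omega :: "nat \<Rightarrow> complex \<Rightarrow> (xz + xz) mp \<Rightarrow> (xz + xz) mp" where
  "exp_Omega n t F = Sum_any (\<lambda>k. mp_const ((- t) ^ k / fact k) * (Omega n ^^ k) F)"

definition star :: "nat \<Rightarrow> complex \<Rightarrow> xz mp \<Rightarrow> xz mp \<Rightarrow> xz mp" where
  "star n t f g = mp_mu (exp_Omega n t (mp_tensor f g))"

definition complex_ring :: "complex ring" where
  "complex_ring = \<lparr>carrier = UNIV, monoid.mult = (*), one = 1, zero = 0, add = (+)\<rparr>"

definition B_alg :: "nat \<Rightarrow> complex \<Rightarrow> (complex, xz mp) module" where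
  "B_alg n t = \<lparr>carrier = xz_ring n, monoid.mult = star n t, one = 1, zero = 0, add = (+),
     module.smult = (\<lambda>c p. mp_const c * p)\<rparr>"

text \<open>The products \<open>\<xi>\<^sub>i f\<^sub>i\<close> are ordinary products of polynomials, not products of \<open>B_alg n t\<close>.\<close>

definition xi_subspace :: "nat \<Rightarrow> xz mp set" where
  "xi_subspace n = {(\<Sum>i<n. mp_var (Xi i) * f i) | f. \<forall>i<n. f i \<in> xz_ring n}"


section \<open>The Jacobian conjecture\<close>

text \<open>A polynomial map from \<open>\<complex>\<^sup>n\<close> to itself is given by its components \<open>F 0, \<dots>, F (n - 1)\<close>.\<close>

definition poly_tuple :: "nat \<Rightarrow> (nat \<Rightarrow> nat mp) \<Rightarrow> bool" where
  "poly_tuple n F \<longleftrightarrow> (\<forall>i<n. F i \<in> mp_ring {..<n})"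

definition poly_map :: "nat \<Rightarrow> (nat \<Rightarrow> nat mp) \<Rightarrow> complex vec \<Rightarrow> complex vec" where
  "poly_map n F x = vec n (\<lambda>i. mp_value (\<lambda>j. x $ j) (F i))"

definition jacobian_matrix :: "nat \<Rightarrow> (nat \<Rightarrow> nat mp) \<Rightarrow> nat mp mat" where
  "jacobian_matrix n F = mat n n (\<lambda>(i, j). mp_deriv j (F i))"

definition jacobian_conjecture :: bool where
  "jacobian_conjecture \<longleftrightarrow>
     (\<forall>n\<ge>1. \<forall>F. poly_tuple n F \<and> (\<exists>c. c \<noteq> 0 \<and> det (jacobian_matrix n F) = mp_const c) \<longrightarrow>
        (\<exists>G. poly_tuple n G \<and>
           (\<forall>x\<in>carrier_vec n. poly_map n G (poly_map n F x) = x \<and>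
                              poly_map n F (poly_map n G x) = x)))"


section \<open>Finiteness of the exponential series\<close>

definition mono_deg :: "('v \<Rightarrow>\<^sub>0 nat) \<Rightarrow> nat" where
  "mono_deg m = (\<Sum>x\<in>Poly_Mapping.keys m. Poly_Mapping.lookup m x)"

lemma mono_deg_superset:
  assumes "finite A" "Poly_Mapping.keys m \<subseteq> A"
  shows "mono_deg m = (\<Sum>x\<in>A. Poly_Mapping.lookup m x)"
  unfolding mono_deg_def
  by (rule sum.mono_neutral_left) (use assms in \<open>auto simp: in_keys_iff\<close>)

lemma mono_deg_diff_single:
  assumes "Poly_Mapping.lookup m x \<noteq> 0"
  shows "mono_deg (m - Poly_Mapping.single x 1) + 1 = mono_deg m"
proof -
  let ?m' = "m - Poly_Mapping.single x 1"
  have look: "Poly_Mapping.lookup ?m' y =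
      Poly_Mapping.lookup m y - (if y = x then 1 else 0)" for y
    by (auto simp: lookup_minus lookup_single when_def)
  have sub: "Poly_Mapping.keys ?m' \<subseteq> Poly_Mapping.keys m"
  proof
    fix y assume "y \<in> Poly_Mapping.keys ?m'"
    then show "y \<in> Poly_Mapping.keys m"
      unfolding in_keys_iff look by linarith
  qed
  have x: "x \<in> Poly_Mapping.keys m"
    using assms by (simp add: in_keys_iff)
  have "mono_deg ?m' = (\<Sum>y\<in>Poly_Mapping.keys m. Poly_Mapping.lookup ?m' y)"
    by (rule mono_deg_superset) (use sub in auto)
  then show ?thesis
    using assms x unfolding mono_deg_def
    by (simp add: sum.remove[OF finite_keys x] look del: One_nat_def)
qed

lemma mp_deriv_bound:
  assumes "\<forall>m\<in>Poly_Mapping.keys p. mono_deg m + k \<le> D"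
  shows "\<forall>m\<in>Poly_Mapping.keys (mp_deriv x p). mono_deg m + Suc k \<le> D"
proof
  fix m assume "m \<in> Poly_Mapping.keys (mp_deriv x p)"
  then obtain m0 where m0: "m0 \<in> Poly_Mapping.keys p"
    and m: "m \<in> Poly_Mapping.keys (Poly_Mapping.single (m0 - Poly_Mapping.single x 1)
       (of_nat (Poly_Mapping.lookup m0 x) * Poly_Mapping.lookup p m0))"
    unfolding mp_deriv_def using keys_sum by fastforce
  have "m = m0 - Poly_Mapping.single x 1" "Poly_Mapping.lookup m0 x \<noteq> 0"
    using m by (auto split: if_splits)
  then show "mono_deg m + Suc k \<le> D"
    using mono_deg_diff_single[of m0 x] assms m0 by fastforce
qed

lemma Omega_bound:
  assumes "\<forall>m\<in>Poly_Mapping.keys F. mono_deg m + k \<le> D"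
  shows "\<forall>m\<in>Poly_Mapping.keys (Omega n F). mono_deg m + Suc k \<le> D"
proof
  fix m assume "m \<in> Poly_Mapping.keys (Omega n F)"
  then obtain i where
    "m \<in> Poly_Mapping.keys (mp_deriv (Inl (Zv i)) (mp_deriv (Inr (Xi i)) F)
                      + mp_deriv (Inl (Xi i)) (mp_deriv (Inr (Zv i)) F))"
    unfolding Omega_def using keys_sum by fastforce
  then have "m \<in> Poly_Mapping.keys (mp_deriv (Inl (Zv i)) (mp_deriv (Inr (Xi i)) F)) \<or>
      m \<in> Poly_Mapping.keys (mp_deriv (Inl (Xi i)) (mp_deriv (Inr (Zv i)) F))"
    using Poly_Mapping.keys_add by fastforce
  then have "mono_deg m + Suc (Suc k) \<le> D"
    using mp_deriv_bound[OF mp_deriv_bound[OF assms]] by blast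
  then show "mono_deg m + Suc k \<le> D" by simp
qed

lemma finite_exp_Omega:
  "finite {k. mp_const ((- t) ^ k / fact k) * (Omega n ^^ k) F \<noteq> 0}"
proof -
  define D where "D = Max (insert 0 (mono_deg ` Poly_Mapping.keys F))"
  have bound: "\<forall>m\<in>Poly_Mapping.keys ((Omega n ^^ k) F). mono_deg m + k \<le> D" for k
  proof (induction k)
    case 0
    show ?case by (auto simp: D_def)
  next
    case (Suc k)
    then show ?case using Omega_bound by simp
  qed
  have "(Omega n ^^ k) F = 0" if "k > D" for k
  proof -
    have "Poly_Mapping.keys ((Omega n ^^ k) F) = {}"
      using bound[of k] that by fastforce
    then show ?thesis
      by (metis Poly_Mapping.poly_mapping_eqI in_keys_iff empty_iff lookup_zero)
  qed
  then have "{k. mp_const ((- t) ^ k / fact k) * (Omega n ^^ k) F \<noteq> 0} \<subseteq> {..D}"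
    by (force simp: not_less[symmetric])
  then show ?thesis by (rule finite_subset) simp
qed

end

theory Submission
  imports Defs
begin

text \<open>
  For a polynomial map \<open>z - H\<close> in \<open>N\<close> variables put
  \<open>A\<^sub>m g = 1/m! \<Sum> \<partial>\<^sub>j\<^sub>1 \<dots> \<partial>\<^sub>j\<^sub>m (g H\<^sub>j\<^sub>1 \<dots> H\<^sub>j\<^sub>m)\<close>, the sum ranging over all tuples of indices, and let \<open>A\<close>
  be the sum of all \<open>A\<^sub>m\<close>.  The Abhyankar--Gurjar formula says that if the Jacobian determinant is 1,
  then \<open>A g\<close> is the composition of \<open>g\<close> with the formal inverse of \<open>z - H\<close>.  The proof shows that under
  the Mathieu hypothesis the series \<open>A g\<close> stops, so that the formal inverse is polynomial.

  The link with the algebras \<open>B_t\<close> is made at \<open>t = - 1\<close>.  There star multiplication by \<open>\<xi>\<^sub>j\<close> is the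
  operator \<open>\<xi>\<^sub>j + \<partial>\<^sub>j\<close>, which becomes \<open>\<partial>\<^sub>j\<close> at \<open>\<xi> = 0\<close>.  Hence, for the star polynomial \<open>a = \<Sum>\<^sub>j \<xi>\<^sub>j \<star> H\<^sub>j\<close>,
  the star product of \<open>g\<close> with the \<open>m\<close>-th star power of \<open>a\<close> takes the value \<open>m! A\<^sub>m g\<close> at \<open>\<xi> = 0\<close>
  (\<open>ev0_star_symbol_pow\<close>).  The subspace in the hypothesis is the kernel of \<open>\<xi> = 0\<close>.  So if
  \<open>A\<^sub>m 1 = 0\<close> for all \<open>m \<ge> 1\<close>, then for every \<open>g\<close> almost all \<open>A\<^sub>m g\<close> vanish
  (\<open>mathieu_imp_ag_op_eventually_zero\<close>).

  The condition \<open>A\<^sub>m 1 = 0\<close> is where the Jacobian determinant enters.  The columns of the inverse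
  Jacobian matrix are divergence-free (Piola, \<open>inverse_jacobian_divergence_free\<close>), and together with
  \<open>A (\<partial>\<^sub>i g) = \<Sum>\<^sub>j \<partial>\<^sub>j A (g \<partial>\<^sub>i (z\<^sub>j - H\<^sub>j))\<close> this makes all derivatives of \<open>A 1\<close> zero.  To conclude
  that the single terms vanish one needs a grading that separates them (\<open>ag_coeff_one\<close>): each \<open>H\<^sub>j\<close>
  should be homogeneous of weight one more than \<open>z\<^sub>j\<close>.  A general \<open>F\<close> is brought into this form by adding a
  block of variables for each degree from 3 up to a bound for the degree of \<open>F\<close>, so that the
  homogeneous parts are fed in one after the other (\<open>normalized_inverse\<close>).

  Finally, \<open>A\<close> being given by finite sums, \<open>A ((z\<^sub>i - H\<^sub>i) g) = z\<^sub>i A g\<close> and \<open>A 1 = 1\<close> show that \<open>A\<close>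
  inverts the substitution of \<open>z - H\<close>, and the polynomials \<open>A z\<^sub>i\<close> are the components of the inverse
  map (\<open>polynomial_inverse_exists\<close>).
\<close>

section \<open>Polynomial rings\<close>

lemma mp_monomial_sum: "p = (\<Sum>m\<in>Poly_Mapping.keys p. Poly_Mapping.single m (Poly_Mapping.lookup p m))"
  by (rule poly_mapping_eqI) (simp add: lookup_sum lookup_single when_def in_keys_iff)

lemma mp_ring_monomial_induct [consumes 1, case_names monomial add]:
  assumes "p \<in> mp_ring V"
    and mono: "\<And>m c. Poly_Mapping.keys m \<subseteq> V \<Longrightarrow> P (Poly_Mapping.single m c)"
    and add: "\<And>p q. P p \<Longrightarrow> P q \<Longrightarrow> P (p + q)"
  shows "P p"
proof -
  have 0: "P 0" using mono[of 0 0] by simp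
  have "P (\<Sum>m\<in>A. Poly_Mapping.single m (Poly_Mapping.lookup p m))"
    if "finite A" "A \<subseteq> Poly_Mapping.keys p" for A
    using that
    by (induction A rule: finite_induct)
       (use 0 assms(1) in \<open>auto intro!: add mono simp: mp_ring_def\<close>)
  from this[of "Poly_Mapping.keys p"] show ?thesis
    by (simp flip: mp_monomial_sum)
qed

lemma mp_ring_UNIV [simp]: "p \<in> mp_ring UNIV"
  by (simp add: mp_ring_def)

lemma single_eq_var_mult:
  assumes "Poly_Mapping.lookup m x \<noteq> 0"
  shows "Poly_Mapping.single m c = mp_var x * Poly_Mapping.single (m - Poly_Mapping.single x 1) c"
proof -
  have "Poly_Mapping.single x 1 + (m - Poly_Mapping.single x 1) = m"
    by (rule poly_mapping_eqI) (use assms in \<open>auto simp: lookup_add lookup_minus lookup_single when_def\<close>)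
  then show ?thesis by (simp add: mp_var_def mult_single del: One_nat_def)
qed

text \<open>Proofs by this rule only meet multiplication by a single variable, so most of the rules
  for substitutions, derivatives and star products below need to be checked only there.\<close>

lemma mp_ring_induct [consumes 1, case_names const add var]:
  assumes "p \<in> mp_ring V"
    and const: "\<And>c. P (mp_const c)"
    and add: "\<And>p q. P p \<Longrightarrow> P q \<Longrightarrow> P (p + q)"
    and var: "\<And>x p. x \<in> V \<Longrightarrow> P p \<Longrightarrow> P (mp_var x * p)"
  shows "P p"
  using assms(1)
proof (induction rule: mp_ring_monomial_induct)
  case (monomial m c)
  then show ?case
  proof (induction "mono_deg m" arbitrary: m)
    case 0
    then have "m = 0"
      by (auto simp: mono_deg_def in_keys_iff intro!: poly_mapping_eqI)
    then show ?case using const by (simp add: mp_const_def)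
  next
    case (Suc d)
    then obtain x where x: "x \<in> Poly_Mapping.keys m"
      by (metis mono_deg_def nat.distinct(1) sum.neutral equals0D)
    let ?m = "m - Poly_Mapping.single x 1"
    have "mono_deg ?m = d"
      using mono_deg_diff_single[of m x] x Suc.hyps(2) by (auto simp: in_keys_iff)
    moreover have "Poly_Mapping.keys ?m \<subseteq> V"
      using Suc.prems by (force simp: in_keys_iff lookup_minus)
    ultimately have "P (Poly_Mapping.single ?m c)" using Suc.hyps(1) by metis
    then have "P (mp_var x * Poly_Mapping.single ?m c)" using var[of x] x Suc.prems by blast
    then show ?case
      using x single_eq_var_mult[of m x c] by (metis in_keys_iff)
  qed
qed (use add in auto)

lemma mp_induct [case_names const add var]:
  assumes "\<And>c. P (mp_const c)" "\<And>p q. P p \<Longrightarrow> P q \<Longrightarrow> P (p + q)"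
    and "\<And>x p. P p \<Longrightarrow> P (mp_var x * p)"
  shows "P p"
  using mp_ring_UNIV[of p] by (induction rule: mp_ring_induct) (use assms in auto)

interpretation mp_const: comm_ring_hom mp_const
  by standard (auto simp: mp_const_def single_add mult_single)

lemma lookup_const_mult [simp]:
  "Poly_Mapping.lookup (mp_const c * p) m = c * Poly_Mapping.lookup p m"
proof -
  have "p \<in> mp_ring UNIV" by simp
  then show ?thesis
    by (induction rule: mp_ring_monomial_induct)
       (auto simp: mp_const_def mult_single lookup_single when_def lookup_add algebra_simps)
qed

lemma lookup_var_mult:
  "Poly_Mapping.lookup (mp_var x * p) m =
     (if Poly_Mapping.lookup m x = 0 then 0 else Poly_Mapping.lookup p (m - Poly_Mapping.single x 1))"
proof -
  have eq: "Poly_Mapping.single x 1 + k = m \<longleftrightarrow>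
      Poly_Mapping.lookup m x \<noteq> 0 \<and> k = m - Poly_Mapping.single x 1" for k
    by (auto simp: poly_mapping_eq_iff fun_eq_iff lookup_add lookup_minus lookup_single when_def)
  have "p \<in> mp_ring UNIV" by simp
  then show ?thesis
  proof (induction rule: mp_ring_monomial_induct)
    case (monomial k c)
    show ?case
      using eq[of k]
      by (auto simp: mp_var_def mult_single lookup_single when_def simp del: One_nat_def)
  qed (auto simp: lookup_add distrib_left)
qed

lemma mp_ring_simps [simp]:
  "mp_const c \<in> mp_ring V" "0 \<in> mp_ring V" "1 \<in> mp_ring V" "mp_var x \<in> mp_ring V \<longleftrightarrow> x \<in> V"
  by (auto simp: mp_ring_def mp_const_def mp_var_def simp flip: single_one split: if_splits)

lemma mp_ring_add [simp]: "p \<in> mp_ring V \<Longrightarrow> q \<in> mp_ring V \<Longrightarrow> p + q \<in> mp_ring V"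
  using Poly_Mapping.keys_add[of p q] by (auto simp: mp_ring_def)

lemma mp_ring_uminus [simp]: "- p \<in> mp_ring V \<longleftrightarrow> p \<in> mp_ring V"
  by (simp add: mp_ring_def in_keys_iff)

lemma mp_ring_diff [simp]: "p \<in> mp_ring V \<Longrightarrow> q \<in> mp_ring V \<Longrightarrow> p - q \<in> mp_ring V"
  using mp_ring_add[of p V "- q"] by simp

lemma mp_ring_sum [simp]: "(\<And>i. i \<in> I \<Longrightarrow> f i \<in> mp_ring V) \<Longrightarrow> sum f I \<in> mp_ring V"
  by (induction I rule: infinite_finite_induct) auto

lemma mp_ring_mult [simp]:
  assumes "p \<in> mp_ring V" "q \<in> mp_ring V"
  shows "p * q \<in> mp_ring V"
proof -
  have "Poly_Mapping.keys (a + b) \<subseteq> V"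
    if "a \<in> Poly_Mapping.keys p" "b \<in> Poly_Mapping.keys q" for a b
    using that assms Poly_Mapping.keys_add[of a b] unfolding mp_ring_def by blast
  then show ?thesis using keys_mult[of p q] by (fastforce simp: mp_ring_def)
qed

lemma mp_ring_mono: "p \<in> mp_ring V \<Longrightarrow> V \<subseteq> W \<Longrightarrow> p \<in> mp_ring W"
  by (auto simp: mp_ring_def)

lemma mp_in_finite_ring: "\<exists>V. finite V \<and> p \<in> mp_ring V"
  by (rule exI[of _ "\<Union>m\<in>Poly_Mapping.keys p. Poly_Mapping.keys m"]) (auto simp: mp_ring_def)


section \<open>Evaluation and substitution\<close>

lemma mp_eval_superset:
  assumes "finite A" "Poly_Mapping.keys p \<subseteq> A" "h 0 = 0"
  shows "mp_eval h v p = (\<Sum>m\<in>A. h (Poly_Mapping.lookup p m) *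
     (\<Prod>x\<in>Poly_Mapping.keys m. v x ^ Poly_Mapping.lookup m x))"
  unfolding mp_eval_def
  by (rule sum.mono_neutral_left) (use assms in \<open>auto simp: in_keys_iff\<close>)

context
  fixes h :: "complex \<Rightarrow> 'b :: comm_ring_1"
  assumes h: "comm_ring_hom h"
begin

interpretation comm_ring_hom h by (fact h)

lemma mp_eval_single:
  "mp_eval h v (Poly_Mapping.single m c) =
     h c * (\<Prod>x\<in>Poly_Mapping.keys m. v x ^ Poly_Mapping.lookup m x)"
  by (cases "c = 0") (auto simp: mp_eval_def)

lemma mp_eval_const: "mp_eval h v (mp_const c) = h c"
  by (simp add: mp_const_def mp_eval_single)

lemma mp_eval_add: "mp_eval h v (p + q) = mp_eval h v p + mp_eval h v q"
proof -
  let ?A = "Poly_Mapping.keys p \<union> Poly_Mapping.keys q"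
  have "Poly_Mapping.keys (p + q) \<subseteq> ?A" by (rule Poly_Mapping.keys_add)
  then show ?thesis
    by (simp add: mp_eval_superset[of ?A] lookup_add hom_add distrib_right sum.distrib)
qed

lemma mp_eval_mult: "mp_eval h v (p * q) = mp_eval h v p * mp_eval h v q"
proof -
  have expand: "(\<Prod>x\<in>Poly_Mapping.keys m. v x ^ Poly_Mapping.lookup m x) =
      (\<Prod>x\<in>A. v x ^ Poly_Mapping.lookup m x)" if "finite A" "Poly_Mapping.keys m \<subseteq> A" for m A
    by (rule prod.mono_neutral_left) (use that in \<open>auto simp: in_keys_iff\<close>)
  have single: "mp_eval h v (Poly_Mapping.single m c * Poly_Mapping.single m' c') =
     mp_eval h v (Poly_Mapping.single m c) * mp_eval h v (Poly_Mapping.single m' c')" for m c m' c'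
  proof -
    let ?A = "Poly_Mapping.keys m \<union> Poly_Mapping.keys m'"
    have e: "k \<in> {m, m', m + m'} \<Longrightarrow> (\<Prod>x\<in>Poly_Mapping.keys k. v x ^ Poly_Mapping.lookup k x) =
        (\<Prod>x\<in>?A. v x ^ Poly_Mapping.lookup k x)" for k
      by (rule expand) (use Poly_Mapping.keys_add[of m m'] in auto)
    have "h (c * c') * (\<Prod>x\<in>?A. v x ^ Poly_Mapping.lookup (m + m') x) =
        h c * (\<Prod>x\<in>?A. v x ^ Poly_Mapping.lookup m x) *
        (h c' * (\<Prod>x\<in>?A. v x ^ Poly_Mapping.lookup m' x))"
      by (simp add: lookup_add power_add prod.distrib hom_mult mult_ac)
    then show ?thesis by (simp only: mult_single mp_eval_single e insert_iff simp_thms)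
  qed
  have "p \<in> mp_ring UNIV" "q \<in> mp_ring UNIV" by simp_all
  then show ?thesis
  proof (induction arbitrary: rule: mp_ring_monomial_induct)
    case (monomial m c)
    from monomial(2) show ?case
      by (induction rule: mp_ring_monomial_induct) (simp_all add: single mp_eval_add distrib_left)
  qed (simp_all add: mp_eval_add distrib_right)
qed

lemma mp_eval_var: "mp_eval h v (mp_var x) = v x"
  by (simp add: mp_var_def mp_eval_single)

lemma comm_ring_hom_mp_eval: "comm_ring_hom (mp_eval h v)"
  by standard
     (use mp_eval_const[of v 0] mp_eval_const[of v 1] in \<open>auto simp: mp_eval_add mp_eval_mult\<close>)

end

interpretation value_hom: comm_ring_hom "mp_value v" for v
  by (rule comm_ring_hom_mp_eval) (unfold_locales; simp)

interpretation subst_hom: comm_ring_hom "mp_subst v" for v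
  by (rule comm_ring_hom_mp_eval) (rule mp_const.comm_ring_hom_axioms)

lemma mp_value_simps [simp]: "mp_value v (mp_const c) = c" "mp_value v (mp_var x) = v x"
  by (rule mp_eval_const mp_eval_var; unfold_locales; simp)+

lemma mp_subst_simps [simp]: "mp_subst v (mp_const c) = mp_const c" "mp_subst v (mp_var x) = v x"
  by (simp_all add: mp_eval_const mp_eval_var mp_const.comm_ring_hom_axioms)

lemma mp_value_subst: "mp_value u (mp_subst v p) = mp_value (\<lambda>x. mp_value u (v x)) p"
  by (induction p rule: mp_induct) (simp_all add: value_hom.hom_add value_hom.hom_mult subst_hom.hom_add subst_hom.hom_mult)

lemma mp_subst_subst: "mp_subst u (mp_subst v p) = mp_subst (\<lambda>x. mp_subst u (v x)) p"
  by (induction p rule: mp_induct) (simp_all add: subst_hom.hom_add subst_hom.hom_mult)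

lemma mp_value_cong:
  assumes "p \<in> mp_ring V" "\<And>x. x \<in> V \<Longrightarrow> u x = v x"
  shows "mp_value u p = mp_value v p"
  using assms(1)
  by (induction rule: mp_ring_induct) (simp_all add: assms(2) value_hom.hom_add value_hom.hom_mult)

lemma mp_subst_in_ring:
  assumes "p \<in> mp_ring V" "\<And>x. x \<in> V \<Longrightarrow> v x \<in> mp_ring W"
  shows "mp_subst v p \<in> mp_ring W"
  using assms(1)
  by (induction rule: mp_ring_induct) (simp_all add: assms(2) subst_hom.hom_add subst_hom.hom_mult)


section \<open>Partial derivatives\<close>

text \<open>A closed form for every coefficient of a derivative: the truncated subtraction in the definition
  becomes an addition on the right, and linearity and commutation are read off coefficientwise.\<close>

lemma lookup_mp_deriv:
  "Poly_Mapping.lookup (mp_deriv x p) m =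
     of_nat (Poly_Mapping.lookup m x + 1) * Poly_Mapping.lookup p (m + Poly_Mapping.single x 1)"
proof -
  have eq: "of_nat (Poly_Mapping.lookup k x) * c = 0 \<or>
      (k - Poly_Mapping.single x 1 = m \<longleftrightarrow> k = m + Poly_Mapping.single x 1)" for k and c :: complex
  proof (cases "Poly_Mapping.lookup k x = 0")
    case False
    then show ?thesis
      by (auto simp: poly_mapping_eq_iff fun_eq_iff lookup_add lookup_minus lookup_single when_def)
  qed simp
  have "Poly_Mapping.lookup (mp_deriv x p) m = (\<Sum>k\<in>Poly_Mapping.keys p.
      of_nat (Poly_Mapping.lookup k x) * Poly_Mapping.lookup p k when k = m + Poly_Mapping.single x 1)"
    unfolding mp_deriv_def lookup_sum
    by (rule sum.cong) (use eq in \<open>auto simp: lookup_single when_def\<close>)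
  also have "\<dots> = of_nat (Poly_Mapping.lookup m x + 1) *
      Poly_Mapping.lookup p (m + Poly_Mapping.single x 1)"
    by (auto simp: when_def in_keys_iff lookup_add)
  finally show ?thesis .
qed

lemma mp_deriv_add [simp]: "mp_deriv x (p + q) = mp_deriv x p + mp_deriv x q"
  by (rule poly_mapping_eqI) (simp add: lookup_mp_deriv lookup_add distrib_left)

lemma mp_deriv_const_mult [simp]: "mp_deriv x (mp_const c * p) = mp_const c * mp_deriv x p"
  by (rule poly_mapping_eqI) (simp add: lookup_mp_deriv)

lemma mp_deriv_zero [simp]: "mp_deriv x 0 = 0"
  by (simp add: mp_deriv_def)

lemma mp_deriv_const [simp]: "mp_deriv x (mp_const c) = 0"
  by (simp add: mp_deriv_def mp_const_def)

lemma mp_deriv_one [simp]: "mp_deriv x 1 = 0"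
  using mp_deriv_const[of x 1] by simp

lemma mp_deriv_uminus [simp]: "mp_deriv x (- p) = - mp_deriv x p"
  by (rule poly_mapping_eqI) (simp add: lookup_mp_deriv)

lemma mp_deriv_diff [simp]: "mp_deriv x (p - q) = mp_deriv x p - mp_deriv x q"
  by (rule poly_mapping_eqI) (simp add: lookup_mp_deriv lookup_minus right_diff_distrib)

lemma mp_deriv_sum: "mp_deriv x (sum f I) = (\<Sum>i\<in>I. mp_deriv x (f i))"
  by (induction I rule: infinite_finite_induct) auto

lemma mp_deriv_commute: "mp_deriv x (mp_deriv y p) = mp_deriv y (mp_deriv x p)"
  by (rule poly_mapping_eqI)
     (cases "x = y"; simp add: lookup_mp_deriv lookup_add lookup_single add.assoc add.commute add.left_commute)

lemma mp_deriv_var_mult: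
  "mp_deriv x (mp_var y * p) = (if x = y then p else 0) + mp_var y * mp_deriv x p"
proof (rule poly_mapping_eqI)
  fix m :: "'a \<Rightarrow>\<^sub>0 nat"
  have *: "m + Poly_Mapping.single x 1 - Poly_Mapping.single y 1 =
      m - Poly_Mapping.single y 1 + Poly_Mapping.single x 1"
    if "x \<noteq> y \<or> Poly_Mapping.lookup m x \<noteq> 0"
    by (rule poly_mapping_eqI)
       (use that in \<open>cases "x = y"; auto simp: lookup_add lookup_minus lookup_single when_def
          simp del: One_nat_def\<close>)
  have "m + Poly_Mapping.single x 1 - Poly_Mapping.single x 1 = m"
    by simp
  then show "Poly_Mapping.lookup (mp_deriv x (mp_var y * p)) m =
      Poly_Mapping.lookup ((if x = y then p else 0) + mp_var y * mp_deriv x p) m"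
    unfolding lookup_mp_deriv lookup_add lookup_var_mult
    using * by (auto simp: lookup_mp_deriv lookup_add lookup_minus lookup_single when_def
        distrib_right left_diff_distrib simp del: One_nat_def)
qed

lemma mp_deriv_var: "mp_deriv x (mp_var y) = (if x = y then 1 else 0)"
  using mp_deriv_var_mult[of x y 1] by simp

lemma mp_deriv_mult: "mp_deriv x (p * q) = mp_deriv x p * q + p * mp_deriv x q"
proof (induction p rule: mp_induct)
  case (var y p)
  show ?case
    unfolding mult.assoc mp_deriv_var_mult var by (simp add: algebra_simps)
qed (simp_all add: distrib_right add_ac)

lemma mp_deriv_outside:
  assumes "p \<in> mp_ring V" "x \<notin> V"
  shows "mp_deriv x p = 0"
  using assms(1) by (induction rule: mp_ring_induct) (use assms(2) in \<open>auto simp: mp_deriv_var_mult\<close>)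

lemma mp_ring_deriv [simp]:
  assumes "p \<in> mp_ring V"
  shows "mp_deriv x p \<in> mp_ring V"
proof -
  have "mp_deriv x p \<in> mp_ring V \<and> p \<in> mp_ring V"
    using assms by (induction rule: mp_ring_induct) (auto simp: mp_deriv_var_mult)
  then show ?thesis by blast
qed

lemma mp_deriv_rename:
  assumes "inj r"
  shows "mp_deriv (r x) (mp_subst (\<lambda>y. mp_var (r y)) p) = mp_subst (\<lambda>y. mp_var (r y)) (mp_deriv x p)"
  by (induction p rule: mp_induct)
     (auto simp: subst_hom.hom_add subst_hom.hom_mult mp_deriv_var_mult inj_eq[OF assms])

lemma mp_deriv_rename_other:
  assumes "x \<notin> range r"
  shows "mp_deriv x (mp_subst (\<lambda>y. mp_var (r y)) p) = 0"
  by (rule mp_deriv_outside[OF mp_subst_in_ring[of _ UNIV] assms]) auto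


section \<open>The star product\<close>

text \<open>\<open>\<Omega>\<close> pairs the derivative by each of the \<open>2n\<close> variables in one tensor factor with the derivative by
  its dual variable in the other.  Hence the commutator of \<open>\<Omega>\<close> with a variable of the tensor square
  is the derivative by that variable's \<open>partner\<close>.\<close>

fun dual :: "xz \<Rightarrow> xz" where
  "dual (Xi i) = Zv i"
| "dual (Zv i) = Xi i"

fun xz_index :: "xz \<Rightarrow> nat" where
  "xz_index (Xi i) = i"
| "xz_index (Zv i) = i"

fun partner :: "xz + xz \<Rightarrow> xz + xz" where
  "partner (Inl x) = Inr (dual x)"
| "partner (Inr x) = Inl (dual x)"

text \<open>This is the star product of a variable with \<open>p\<close> at \<open>t = - 1\<close>, written without any exponential
  series; \<open>star_var_star_left\<close> with \<open>p = 1\<close> turns it into that product.\<close>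

definition var_star :: "xz \<Rightarrow> xz mp \<Rightarrow> xz mp" where
  "var_star x p = mp_var x * p + mp_deriv (dual x) p"

lemma Omega_add: "Omega n (F + G) = Omega n F + Omega n G"
  by (simp add: Omega_def sum.distrib add_ac)

lemma Omega_const_mult: "Omega n (mp_const c * F) = mp_const c * Omega n F"
  by (simp add: Omega_def sum_distrib_left distrib_left)

lemma Omega_zero [simp]: "Omega n 0 = 0"
  by (simp add: Omega_def)

lemma Omega_deriv: "Omega n (mp_deriv y F) = mp_deriv y (Omega n F)"
  by (simp add: Omega_def mp_deriv_sum mp_deriv_commute[of y])

lemma Omega_var_mult:
  assumes "xz_index (case_sum id id y) < n"
  shows "Omega n (mp_var y * F) = mp_var y * Omega n F + mp_deriv (partner y) F"
proof -
  define i where "i = xz_index (case_sum id id y)"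
  define T where "T j G = mp_deriv (Inl (Zv j)) (mp_deriv (Inr (Xi j)) G)
      + mp_deriv (Inl (Xi j)) (mp_deriv (Inr (Zv j)) G)" for j G
  have y: "y \<in> {Inl (Xi i), Inl (Zv i), Inr (Xi i), Inr (Zv i)}"
    unfolding i_def by (cases y; cases "case_sum id id y") auto
  have "T j (mp_var y * F) = mp_var y * T j F + (if j = i then mp_deriv (partner y) F else 0)" for j
    unfolding T_def using y by (auto simp: mp_deriv_var_mult distrib_left)
  then have "Omega n (mp_var y * F) =
      (\<Sum>j<n. mp_var y * T j F) + (\<Sum>j<n. if j = i then mp_deriv (partner y) F else 0)"
    unfolding Omega_def T_def[symmetric] by (simp add: sum.distrib)
  then show ?thesis
    using assms by (simp add: Omega_def T_def sum_distrib_left i_def)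
qed

lemma exp_Omega_eq_sum:
  "\<exists>K0. \<forall>K\<ge>K0. exp_Omega n t F = (\<Sum>k<K. mp_const ((- t) ^ k / fact k) * (Omega n ^^ k) F)"
proof -
  let ?S = "{k. mp_const ((- t) ^ k / fact k) * (Omega n ^^ k) F \<noteq> 0}"
  from finite_nat_bounded[OF finite_exp_Omega[of t n F]] obtain K0 where K0: "?S \<subseteq> {..<K0}" by blast
  have "exp_Omega n t F = (\<Sum>k<K. mp_const ((- t) ^ k / fact k) * (Omega n ^^ k) F)"
    if "K \<ge> K0" for K
    unfolding exp_Omega_def
    by (rule Sum_any.expand_superset) (use K0 that in auto)
  then show ?thesis by blast
qed

lemma const_fact_Suc: "mp_const (1 / fact (Suc m)) * (mp_const (of_nat (Suc m)) * g) = mp_const (1 / fact m) * g"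
proof -
  have "1 / fact (Suc m) * of_nat (Suc m) = (1 / fact m :: complex)"
    using of_nat_neq_0[of m] by (simp add: fact_Suc del: of_nat_Suc)
  then show ?thesis by (metis mult.assoc mp_const.hom_mult)
qed

text \<open>If \<open>R = [\<Omega>, S]\<close> commutes with \<open>\<Omega>\<close>, then \<open>[\<Omega>\<^sup>k, S] = k R \<Omega>\<^sup>k\<^sup>-\<^sup>1\<close>, and summing over \<open>k\<close> gives
  \<open>exp \<Omega> S = (S + R) exp \<Omega>\<close>.  The commutation rules for star products are all cases of this: \<open>S\<close> is
  multiplication by a variable or a constant, or a derivative.\<close>

lemma exp_Omega_intertwine:
  assumes S: "\<And>F. Omega n (S F) = S (Omega n F) + R F"
    and R: "\<And>F. Omega n (R F) = R (Omega n F)"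
    and linear: "\<And>F G. S (F + G) = S F + S G" "\<And>F G. R (F + G) = R F + R G"
      "\<And>c F. S (mp_const c * F) = mp_const c * S F" "\<And>c F. R (mp_const c * F) = mp_const c * R F"
  shows "exp_Omega n (- 1) (S F) = S (exp_Omega n (- 1) F) + R (exp_Omega n (- 1) F)"
proof -
  have zero: "S 0 = 0" "R 0 = 0"
    using linear(3)[of 0 0] linear(4)[of 0 0] by simp_all
  have sum: "S (sum f A) = (\<Sum>i\<in>A. S (f i))" "R (sum f A) = (\<Sum>i\<in>A. R (f i))"
    for f and A :: "nat set"
    by (induction A rule: infinite_finite_induct; simp add: zero linear)+
  have Rpow: "(Omega n ^^ k) (R F) = R ((Omega n ^^ k) F)" for k
    by (induction k) (simp_all add: R)
  have Spow: "(Omega n ^^ Suc k) (S F) =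
      S ((Omega n ^^ Suc k) F) + mp_const (of_nat (Suc k)) * R ((Omega n ^^ k) F)" for k
  proof (induction k)
    case (Suc k)
    have "(Omega n ^^ Suc (Suc k)) (S F) = Omega n ((Omega n ^^ Suc k) (S F))" by simp
    also have "\<dots> = S ((Omega n ^^ Suc (Suc k)) F) +
        (R ((Omega n ^^ Suc k) F) + mp_const (of_nat (Suc k)) * R ((Omega n ^^ Suc k) F))"
      unfolding Suc.IH Omega_add Omega_const_mult S R by (simp add: add_ac)
    also have "R ((Omega n ^^ Suc k) F) + mp_const (of_nat (Suc k)) * R ((Omega n ^^ Suc k) F) =
        mp_const (of_nat (Suc (Suc k))) * R ((Omega n ^^ Suc k) F)"
      by (simp only: of_nat_Suc[of "Suc k"] mp_const.hom_add mp_const.hom_one distrib_right mult_1_left)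
    finally show ?case .
  qed (simp add: S)
  obtain K1 K2 where K:
    "\<And>K. K \<ge> K1 \<Longrightarrow> exp_Omega n (- 1) F = (\<Sum>k<K. mp_const (1 / fact k) * (Omega n ^^ k) F)"
    "\<And>K. K \<ge> K2 \<Longrightarrow> exp_Omega n (- 1) (S F) = (\<Sum>k<K. mp_const (1 / fact k) * (Omega n ^^ k) (S F))"
    using exp_Omega_eq_sum[of n "- 1" F] exp_Omega_eq_sum[of n "- 1" "S F"] by auto
  define K where "K = K1 + K2"
  have "exp_Omega n (- 1) (S F) = (\<Sum>k<Suc K. mp_const (1 / fact k) * (Omega n ^^ k) (S F))"
    by (rule K) (simp add: K_def)
  also have "\<dots> = S F + (\<Sum>k<K. mp_const (1 / fact (Suc k)) * (Omega n ^^ Suc k) (S F))"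
    unfolding sum.lessThan_Suc_shift by simp
  also have "\<dots> = S F + (\<Sum>k<K. S (mp_const (1 / fact (Suc k)) * (Omega n ^^ Suc k) F))
      + (\<Sum>k<K. R (mp_const (1 / fact k) * (Omega n ^^ k) F))"
    unfolding Spow distrib_left const_fact_Suc linear sum.distrib by (simp add: add_ac)
  also have "S F + (\<Sum>k<K. S (mp_const (1 / fact (Suc k)) * (Omega n ^^ Suc k) F)) =
      S (\<Sum>k<Suc K. mp_const (1 / fact k) * (Omega n ^^ k) F)"
    unfolding sum.lessThan_Suc_shift linear(1) sum by simp
  also have "\<dots> = S (exp_Omega n (- 1) F)"
    by (subst K(1)[of "Suc K"]) (simp_all add: K_def)
  also have "(\<Sum>k<K. R (mp_const (1 / fact k) * (Omega n ^^ k) F)) = R (exp_Omega n (- 1) F)"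
    by (subst K(1)[of K]) (simp_all add: K_def sum)
  finally show ?thesis .
qed

lemma exp_Omega_deriv: "exp_Omega n (- 1) (mp_deriv y F) = mp_deriv y (exp_Omega n (- 1) F)"
  using exp_Omega_intertwine[of n "mp_deriv y" "\<lambda>_. 0" F] by (simp add: Omega_deriv)

lemma exp_Omega_const_mult: "exp_Omega n (- 1) (mp_const c * F) = mp_const c * exp_Omega n (- 1) F"
  using exp_Omega_intertwine[of n "\<lambda>F. mp_const c * F" "\<lambda>_. 0" F]
  by (simp add: Omega_const_mult distrib_left mult.left_commute)

lemma exp_Omega_var_mult:
  assumes "xz_index (case_sum id id y) < n"
  shows "exp_Omega n (- 1) (mp_var y * F) =
    mp_var y * exp_Omega n (- 1) F + mp_deriv (partner y) (exp_Omega n (- 1) F)"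
  by (rule exp_Omega_intertwine)
     (simp_all add: Omega_var_mult[OF assms] Omega_deriv distrib_left mult.left_commute)

lemma exp_Omega_add: "exp_Omega n (- 1) (F + G) = exp_Omega n (- 1) F + exp_Omega n (- 1) G"
proof -
  have pow: "(Omega n ^^ k) (F + G) = (Omega n ^^ k) F + (Omega n ^^ k) G" for k
    by (induction k) (simp_all add: Omega_add)
  obtain K1 K2 K3 where
    "\<And>K. K \<ge> K1 \<Longrightarrow> exp_Omega n (- 1) F = (\<Sum>k<K. mp_const (1 / fact k) * (Omega n ^^ k) F)"
    "\<And>K. K \<ge> K2 \<Longrightarrow> exp_Omega n (- 1) G = (\<Sum>k<K. mp_const (1 / fact k) * (Omega n ^^ k) G)"
    "\<And>K. K \<ge> K3 \<Longrightarrow> exp_Omega n (- 1) (F + G) =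
        (\<Sum>k<K. mp_const (1 / fact k) * (Omega n ^^ k) (F + G))"
    using exp_Omega_eq_sum[of n "- 1" F] exp_Omega_eq_sum[of n "- 1" G]
      exp_Omega_eq_sum[of n "- 1" "F + G"] by auto
  from this[of "K1 + K2 + K3"] show ?thesis
    by (simp add: pow distrib_left sum.distrib)
qed

lemma exp_Omega_of_kernel:
  assumes "Omega n F = 0"
  shows "exp_Omega n (- 1) F = F"
proof -
  have "(Omega n ^^ Suc k) F = 0" for k
    by (induction k) (simp_all add: assms)
  then have "mp_const ((- (- 1)) ^ k / fact k) * (Omega n ^^ k) F = (if k = 0 then F else 0)" for k
    by (cases k) simp_all
  moreover obtain K where "exp_Omega n (- 1) F =
      (\<Sum>k<Suc K. mp_const ((- (- 1)) ^ k / fact k) * (Omega n ^^ k) F)"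
    using exp_Omega_eq_sum[of n "- 1" F] le_Suc_eq by blast
  ultimately show ?thesis by simp
qed

lemma mp_deriv_other_factor [simp]:
  "mp_deriv (Inl x) (mp_subst (\<lambda>y. mp_var (Inr y)) p) = 0"
  "mp_deriv (Inr x) (mp_subst (\<lambda>y. mp_var (Inl y)) p) = 0"
  by (rule mp_deriv_rename_other; auto)+

lemma mp_deriv_mu:
  "mp_deriv x (mp_mu F) = mp_mu (mp_deriv (Inl x) F) + mp_mu (mp_deriv (Inr x) F)"
proof (induction F rule: mp_induct)
  case (var y F)
  show ?case
    unfolding mp_mu_def mp_deriv_var_mult subst_hom.hom_add subst_hom.hom_mult
    by (cases y) (auto simp: mp_deriv_var_mult var[unfolded mp_mu_def] distrib_left)
qed (simp_all add: mp_mu_def subst_hom.hom_add)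

lemma mp_subst_var [simp]: "mp_subst mp_var p = p"
  by (induction p rule: mp_induct) (simp_all add: subst_hom.hom_add subst_hom.hom_mult)

context
  fixes n :: nat
begin

abbreviation star1 :: "xz mp \<Rightarrow> xz mp \<Rightarrow> xz mp" where
  "star1 \<equiv> star n (- 1)"

lemma star_add_left: "star1 (p + p') q = star1 p q + star1 p' q"
  by (simp add: star_def mp_tensor_def subst_hom.hom_add distrib_right exp_Omega_add mp_mu_def)

lemma star_add_right: "star1 p (q + q') = star1 p q + star1 p q'"
  by (simp add: star_def mp_tensor_def subst_hom.hom_add distrib_left exp_Omega_add mp_mu_def)

lemma star_const_mult_left: "star1 (mp_const c * p) q = mp_const c * star1 p q"
  by (simp add: star_def mp_tensor_def subst_hom.hom_mult mult.assoc exp_Omega_const_mult mp_mu_def)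

lemma star_const_mult_right: "star1 p (mp_const c * q) = mp_const c * star1 p q"
  by (simp add: star_def mp_tensor_def subst_hom.hom_mult mult.left_commute exp_Omega_const_mult mp_mu_def)

lemma star_zero: "star1 0 q = 0" "star1 p 0 = 0"
  using star_const_mult_left[of 0 0 q] star_const_mult_right[of p 0 0] by simp_all

lemma star_sum_left: "star1 (sum f A) q = (\<Sum>i\<in>A. star1 (f i) q)"
  by (induction A rule: infinite_finite_induct) (simp_all add: star_zero star_add_left)

lemma star_sum_right: "star1 p (sum f A) = (\<Sum>i\<in>A. star1 p (f i))"
  by (induction A rule: infinite_finite_induct) (simp_all add: star_zero star_add_right)

lemma star_one_left: "star1 1 q = q"
proof -
  have "Omega n (mp_tensor 1 q) = 0"
    unfolding Omega_def mp_tensor_def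
    by (simp add: mp_deriv_commute[of "Inl _" "Inr _"])
  then show ?thesis
    by (simp add: star_def exp_Omega_of_kernel) (simp add: mp_tensor_def mp_mu_def mp_subst_subst)
qed

lemma star_one_right: "star1 p 1 = p"
proof -
  have "Omega n (mp_tensor p 1) = 0"
    unfolding Omega_def mp_tensor_def by simp
  then show ?thesis
    by (simp add: star_def exp_Omega_of_kernel) (simp add: mp_tensor_def mp_mu_def mp_subst_subst)
qed

lemma star_const: "star1 (mp_const c) q = mp_const c * q" "star1 p (mp_const c) = mp_const c * p"
  using star_const_mult_left[of c 1 q] star_const_mult_right[of p c 1]
  by (simp_all add: star_one_left star_one_right)

text \<open>Together with its mirror image, this replaces general associativity and commutativity of the
  star product: the operator \<open>var_star x\<close> can be pulled out of either factor.  Multiplication by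
  \<open>x\<close> contributes the derivative by \<open>dual x\<close> in the other factor, the derivative inside \<open>var_star\<close>
  contributes the one in the same factor, and under \<open>mp_mu\<close> the two add up to a derivative of the
  product.\<close>

lemma star_var_star_left:
  assumes "xz_index x < n"
  shows "star1 (var_star x p) q = var_star x (star1 p q)"
proof -
  let ?E = "exp_Omega n (- 1) (mp_tensor p q)"
  have "mp_deriv (Inl (dual x)) (mp_tensor p q) = mp_tensor (mp_deriv (dual x) p) q"
    by (simp add: mp_tensor_def mp_deriv_mult mp_deriv_rename)
  then have "mp_tensor (var_star x p) q = mp_var (Inl x) * mp_tensor p q + mp_deriv (Inl (dual x)) (mp_tensor p q)"
    by (simp add: var_star_def mp_tensor_def subst_hom.hom_add subst_hom.hom_mult distrib_right mult.assoc)
  then have "exp_Omega n (- 1) (mp_tensor (var_star x p) q) =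
      mp_var (Inl x) * ?E + mp_deriv (Inr (dual x)) ?E + mp_deriv (Inl (dual x)) ?E"
    using assms by (simp add: exp_Omega_add exp_Omega_var_mult exp_Omega_deriv)
  then show ?thesis
    unfolding star_def var_star_def mp_deriv_mu
    by (simp add: mp_mu_def subst_hom.hom_add subst_hom.hom_mult)
qed

lemma star_var_star_right:
  assumes "xz_index x < n"
  shows "star1 p (var_star x q) = var_star x (star1 p q)"
proof -
  let ?E = "exp_Omega n (- 1) (mp_tensor p q)"
  have "mp_deriv (Inr (dual x)) (mp_tensor p q) = mp_tensor p (mp_deriv (dual x) q)"
    by (simp add: mp_tensor_def mp_deriv_mult mp_deriv_rename)
  then have "mp_tensor p (var_star x q) = mp_var (Inr x) * mp_tensor p q + mp_deriv (Inr (dual x)) (mp_tensor p q)"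
    by (simp add: var_star_def mp_tensor_def subst_hom.hom_add subst_hom.hom_mult algebra_simps)
  then have "exp_Omega n (- 1) (mp_tensor p (var_star x q)) =
      mp_var (Inr x) * ?E + mp_deriv (Inl (dual x)) ?E + mp_deriv (Inr (dual x)) ?E"
    using assms by (simp add: exp_Omega_add exp_Omega_var_mult exp_Omega_deriv)
  then show ?thesis
    unfolding star_def var_star_def mp_deriv_mu
    by (simp add: mp_mu_def subst_hom.hom_add subst_hom.hom_mult)
qed

end


section \<open>Star powers of a symbol linear in the \<open>\<xi>\<^sub>i\<close>\<close>

abbreviation up :: "nat mp \<Rightarrow> xz mp" where
  "up \<equiv> mp_subst (\<lambda>k. mp_var (Zv k))"

text \<open>Setting \<open>\<xi> = 0\<close>, whose kernel is the subspace that the Mathieu hypothesis speaks about.\<close>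

definition ev0 :: "xz mp \<Rightarrow> nat mp" where
  "ev0 = mp_subst (case_xz (\<lambda>_. 0) mp_var)"

interpretation ev0: comm_ring_hom ev0
  unfolding ev0_def by (rule subst_hom.comm_ring_hom_axioms)

text \<open>The terms of the Abhyankar--Gurjar inversion formula for \<open>z - H\<close> up to the factor \<open>m!\<close>:
  \<open>ag_op H N m g\<close> is the sum of \<open>\<partial>\<^sub>j\<^sub>1 \<dots> \<partial>\<^sub>j\<^sub>m (g H\<^sub>j\<^sub>1 \<dots> H\<^sub>j\<^sub>m)\<close> over all index tuples.  The recursion
  moves one \<open>H\<^sub>j\<close> at a time past its derivative, which is the form in which star powers of the symbol
  and weights are compared with it.\<close>

primrec ag_op :: "(nat \<Rightarrow> nat mp) \<Rightarrow> nat \<Rightarrow> nat \<Rightarrow> nat mp \<Rightarrow> nat mp" where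
  "ag_op H N 0 g = g"
| "ag_op H N (Suc m) g = (\<Sum>j<N. mp_deriv j (ag_op H N m (g * H j)))"

lemma ev0_simps [simp]:
  "ev0 (mp_const c) = mp_const c" "ev0 (mp_var (Xi i)) = 0" "ev0 (mp_var (Zv i)) = mp_var i"
  by (simp_all add: ev0_def)

lemma ev0_up [simp]: "ev0 (up g) = g"
  by (simp add: ev0_def mp_subst_subst)

lemma up_in_xz_ring: "g \<in> mp_ring {..<n} \<Longrightarrow> up g \<in> xz_ring n"
  unfolding xz_ring_def by (rule mp_subst_in_ring) auto

lemma ev0_deriv: "ev0 (mp_deriv (Zv i) p) = mp_deriv i (ev0 p)"
proof (induction p rule: mp_induct)
  case (var x p)
  then show ?case
    by (cases x) (auto simp: mp_deriv_var_mult ev0.hom_add ev0.hom_mult)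
qed (simp_all add: ev0.hom_add)

lemma ev0_var_star: "ev0 (var_star (Xi j) p) = mp_deriv j (ev0 p)"
  by (simp add: var_star_def ev0.hom_add ev0.hom_mult ev0_deriv)

lemma var_star_up: "var_star (Zv k) (up g) = up (mp_var k * g)"
  using mp_deriv_rename_other[of "Xi k" Zv g] by (auto simp: var_star_def subst_hom.hom_mult)

lemma var_star_in_xz_ring: "p \<in> xz_ring n \<Longrightarrow> xz_index x < n \<Longrightarrow> var_star x p \<in> xz_ring n"
  by (cases x) (auto simp: var_star_def xz_ring_def)

text \<open>Polynomials in \<open>z\<close> alone are iterated star products of variables by \<open>var_star_up\<close>, so they
  associate and commute with everything.\<close>

lemma star_up_assoc:
  assumes "g \<in> mp_ring {..<n}"
  shows "star n (- 1) (star n (- 1) (up g) p) q = star n (- 1) (up g) (star n (- 1) p q)"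
  using assms
  by (induction rule: mp_ring_induct)
     (simp_all add: star_const star_const_mult_left star_add_left subst_hom.hom_add star_var_star_left flip: var_star_up)

lemma star_up_swap:
  assumes "g \<in> mp_ring {..<n}"
  shows "star n (- 1) p (star n (- 1) (up g) q) = star n (- 1) (up g) (star n (- 1) p q)"
  using assms
  by (induction rule: mp_ring_induct)
     (simp_all add: star_const star_const_mult_right star_add_right star_add_left subst_hom.hom_add
       star_var_star_right star_var_star_left flip: var_star_up)

lemma star_up_up:
  assumes "g \<in> mp_ring {..<n}"
  shows "star n (- 1) (up g) (up h) = up (g * h)"
  using assms
proof (induction rule: mp_ring_induct)
  case (var x p)
  then show ?case by (simp add: star_var_star_left mult.assoc flip: var_star_up)
qed (simp_all add: star_const star_add_left subst_hom.hom_add subst_hom.hom_mult distrib_right)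

text \<open>The star polynomial \<open>symbol\<close> is \<open>\<Sum>\<^sub>j \<xi>\<^sub>j \<star> H\<^sub>j\<close>.  Pulling the \<open>\<xi>\<^sub>j\<close> of one factor of its star power
  to the outside and setting \<open>\<xi> = 0\<close> turns \<open>\<xi>\<^sub>j\<close> into \<open>\<partial>\<^sub>j\<close>; repeated \<open>m\<close> times, this identifies
  \<open>g \<star> symbol\<^sup>m\<close> at \<open>\<xi> = 0\<close> with \<open>ag_op H N m g\<close>.\<close>

context
  fixes n N :: nat and H :: "nat \<Rightarrow> nat mp"
  assumes N: "N \<le> n" and H: "\<And>j. j < N \<Longrightarrow> H j \<in> mp_ring {..<n}"
begin

definition symbol :: "xz mp" where
  "symbol = (\<Sum>j<N. var_star (Xi j) (up (H j)))"

primrec symbol_pow :: "nat \<Rightarrow> xz mp" where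
  "symbol_pow 0 = 1"
| "symbol_pow (Suc m) = star n (- 1) (symbol_pow m) symbol"

lemma star_symbol_left: "star n (- 1) symbol q = (\<Sum>j<N. var_star (Xi j) (star n (- 1) (up (H j)) q))"
  unfolding symbol_def star_sum_left by (rule sum.cong) (use N in \<open>auto simp: star_var_star_left\<close>)

lemma star_symbol_right: "star n (- 1) q symbol = star n (- 1) symbol q"
proof -
  have "star n (- 1) q (up (H j)) = star n (- 1) (up (H j)) q" if "j < N" for j
    using star_up_swap[OF H[OF that], of q 1] by (simp add: star_one_right)
  then show ?thesis
    unfolding star_symbol_left unfolding symbol_def star_sum_right
    by (intro sum.cong) (use N in \<open>auto simp: star_var_star_right\<close>)
qed

lemma star_up_symbol_pow_Suc:
  assumes "g \<in> mp_ring {..<n}"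
  shows "star n (- 1) (up g) (symbol_pow (Suc m)) =
    (\<Sum>j<N. var_star (Xi j) (star n (- 1) (up (g * H j)) (symbol_pow m)))"
proof -
  have "star n (- 1) (up g) (symbol_pow (Suc m)) =
      (\<Sum>j<N. star n (- 1) (up g) (var_star (Xi j) (star n (- 1) (up (H j)) (symbol_pow m))))"
    by (simp add: star_symbol_right star_symbol_left star_sum_right)
  also have "\<dots> = (\<Sum>j<N. var_star (Xi j) (star n (- 1) (up (g * H j)) (symbol_pow m)))"
    by (rule sum.cong)
       (use N assms in \<open>auto simp: star_var_star_right simp flip: star_up_assoc star_up_up\<close>)
  finally show ?thesis .
qed

lemma ev0_star_symbol_pow:
  assumes "g \<in> mp_ring {..<n}"
  shows "star n (- 1) (up g) (symbol_pow m) \<in> xz_ring n"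
    and "ev0 (star n (- 1) (up g) (symbol_pow m)) = ag_op H N m g"
proof -
  have "star n (- 1) (up g) (symbol_pow m) \<in> xz_ring n \<and>
      ev0 (star n (- 1) (up g) (symbol_pow m)) = ag_op H N m g"
    using assms
  proof (induction m arbitrary: g)
    case 0
    then show ?case by (simp add: star_one_right up_in_xz_ring)
  next
    case (Suc m)
    then have IH: "star n (- 1) (up (g * H j)) (symbol_pow m) \<in> xz_ring n"
        "ev0 (star n (- 1) (up (g * H j)) (symbol_pow m)) = ag_op H N m (g * H j)" if "j < N" for j
      using H that by simp_all
    then show ?case
      unfolding star_up_symbol_pow_Suc[OF Suc.prems] ev0.hom_sum ev0_var_star
      using N var_star_in_xz_ring by (force simp: xz_ring_def intro!: sum.cong mp_ring_sum)
  qed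
  then show "star n (- 1) (up g) (symbol_pow m) \<in> xz_ring n"
    and "ev0 (star n (- 1) (up g) (symbol_pow m)) = ag_op H N m g" by auto
qed

lemma symbol_in_xz_ring: "symbol \<in> xz_ring n"
  using ev0_star_symbol_pow(1)[of 1 1] by (simp add: star_one_left)

lemma pow_symbol: "symbol [^]\<^bsub>B_alg n (- 1)\<^esub> m = symbol_pow m"
  by (induction m) (simp_all add: nat_pow_def B_alg_def)

end

lemma xi_subspace_iff: "p \<in> xi_subspace n \<longleftrightarrow> p \<in> xz_ring n \<and> ev0 p = 0"
proof
  assume "p \<in> xi_subspace n"
  then obtain f where f: "p = (\<Sum>i<n. mp_var (Xi i) * f i)" "\<And>i. i < n \<Longrightarrow> f i \<in> xz_ring n"
    unfolding xi_subspace_def by blast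
  then show "p \<in> xz_ring n \<and> ev0 p = 0"
    unfolding f(1) by (auto simp: xz_ring_def ev0.hom_sum ev0.hom_mult intro!: mp_ring_sum mp_ring_mult)
next
  assume p: "p \<in> xz_ring n \<and> ev0 p = 0"
  have "\<exists>f. (\<forall>i<n. f i \<in> xz_ring n) \<and> p = up (ev0 p) + (\<Sum>i<n. mp_var (Xi i) * f i)"
    if "p \<in> xz_ring n" for p
  proof -
    have "p \<in> xz_ring n \<and>
      (\<exists>f. (\<forall>i<n. f i \<in> xz_ring n) \<and> p = up (ev0 p) + (\<Sum>i<n. mp_var (Xi i) * f i))"
      using that[unfolded xz_ring_def]
    proof (induction rule: mp_ring_induct)
      case (const c)
      show ?case by (auto simp: xz_ring_def intro!: exI[of _ "\<lambda>_. 0"])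
    next
      case (add p q)
      then obtain f g where fg: "\<forall>i<n. f i \<in> xz_ring n" "\<forall>i<n. g i \<in> xz_ring n"
          "p = up (ev0 p) + (\<Sum>i<n. mp_var (Xi i) * f i)" "q = up (ev0 q) + (\<Sum>i<n. mp_var (Xi i) * g i)"
        by blast
      have "p + q = up (ev0 (p + q)) + (\<Sum>i<n. mp_var (Xi i) * (f i + g i))"
        by (subst fg(3), subst fg(4))
           (simp add: ev0.hom_add subst_hom.hom_add distrib_left sum.distrib)
      with add fg(1,2) show ?case
        by (intro conjI exI[of _ "\<lambda>i. f i + g i"]) (auto simp: xz_ring_def)
    next
      case (var x p)
      then obtain f where f: "\<forall>i<n. f i \<in> xz_ring n" "p = up (ev0 p) + (\<Sum>i<n. mp_var (Xi i) * f i)"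
        and p: "p \<in> xz_ring n"
        by blast
      show ?case
      proof (cases x)
        case (Xi j)
        with var have j: "j < n" by auto
        have "(\<Sum>i<n. mp_var (Xi i) * (if i = j then p else 0)) = mp_var (Xi j) * p"
          using j by (simp add: if_distrib cong: if_cong)
        then show ?thesis
          using p j Xi by (intro conjI exI[of _ "\<lambda>i. if i = j then p else 0"])
            (auto simp: xz_ring_def ev0.hom_mult)
      next
        case (Zv j)
        with var have j: "j < n" by auto
        have "mp_var x * p = up (ev0 (mp_var x * p)) + (\<Sum>i<n. mp_var (Xi i) * (mp_var x * f i))"
          by (subst f(2)) (simp add: Zv ev0.hom_mult subst_hom.hom_mult distrib_left sum_distrib_left mult.left_commute)
        then show ?thesis
          using p j Zv f(1) by (intro conjI exI[of _ "\<lambda>i. mp_var x * f i"]) (auto simp: xz_ring_def)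
      qed
    qed
    then show ?thesis by blast
  qed
  from this[of p] p obtain f where "\<forall>i<n. f i \<in> xz_ring n" "p = (\<Sum>i<n. mp_var (Xi i) * f i)"
    by auto
  then show "p \<in> xi_subspace n" unfolding xi_subspace_def by blast
qed

text \<open>The only use of the Mathieu hypothesis.  The number of variables is chosen after \<open>g\<close>, large
  enough for \<open>g\<close>, so that the conclusion holds for polynomials in all variables at once.\<close>

lemma mathieu_imp_ag_op_eventually_zero:
  assumes mathieu: "\<forall>n\<ge>1. \<forall>t::complex. mathieu_subspace complex_ring (B_alg n t) (xi_subspace n)"
    and H: "\<And>j. j < N \<Longrightarrow> H j \<in> mp_ring {..<N}"
    and zero: "\<And>m. m \<ge> 1 \<Longrightarrow> ag_op H N m 1 = 0"
  shows "\<exists>M. \<forall>m\<ge>M. ag_op H N m g = 0"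
proof -
  obtain V where V: "finite V" "g \<in> mp_ring V" using mp_in_finite_ring by blast
  obtain n where n: "n \<ge> 1" "N \<le> n" "V \<subseteq> {..<n}"
  proof -
    from finite_nat_bounded[OF V(1)] obtain k where "V \<subseteq> {..<k}" by blast
    then show ?thesis by (intro that[of "k + N + 1"]) auto
  qed
  have g: "g \<in> mp_ring {..<n}" using V(2) n(3) mp_ring_mono by blast
  have Hn: "\<And>j. j < N \<Longrightarrow> H j \<in> mp_ring {..<n}"
    using H n(2) mp_ring_mono[of _ "{..<N}" "{..<n}"] by auto
  let ?a = "symbol N H"
  have "?a [^]\<^bsub>B_alg n (- 1)\<^esub> m \<in> xi_subspace n" if "m \<ge> 1" for m :: nat
    using ev0_star_symbol_pow[of N n H 1 m] n(2) Hn zero[OF that]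
    by (simp add: pow_symbol[of N n H] xi_subspace_iff star_one_left)
  moreover have "?a \<in> carrier (B_alg n (- 1))" "up g \<in> carrier (B_alg n (- 1))"
    using symbol_in_xz_ring[of N n H] n(2) Hn up_in_xz_ring[OF g] by (simp_all add: B_alg_def)
  ultimately obtain M :: nat where
    "\<forall>m\<ge>M. up g \<otimes>\<^bsub>B_alg n (- 1)\<^esub> ?a [^]\<^bsub>B_alg n (- 1)\<^esub> m \<in> xi_subspace n"
    using mathieu n(1) unfolding mathieu_subspace_def by blast
  then have "\<forall>m\<ge>M. star n (- 1) (up g) (symbol_pow n N H m) \<in> xi_subspace n"
    using pow_symbol[of N n H] n(2) Hn by (simp add: B_alg_def)
  then show ?thesis
    using ev0_star_symbol_pow(2)[of N n H g] n(2) Hn g by (auto simp: xi_subspace_iff)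
qed


section \<open>Weighted orders\<close>

lemma mp_nonzero_key: "p \<noteq> 0 \<Longrightarrow> \<exists>m. m \<in> Poly_Mapping.keys p"
  by (metis in_keys_iff lookup_zero poly_mapping_eqI)

definition wt :: "('v \<Rightarrow> int) \<Rightarrow> ('v \<Rightarrow>\<^sub>0 nat) \<Rightarrow> int" where
  "wt w m = (\<Sum>x\<in>Poly_Mapping.keys m. w x * int (Poly_Mapping.lookup m x))"

text \<open>Weights may be negative: homogeneity of weight \<open>d\<close> is the conjunction of order at least \<open>d\<close> for
  \<open>w\<close> and order at least \<open>- d\<close> for \<open>- w\<close>, so that one lemma about orders serves both purposes.\<close>

definition wt_ge :: "('v \<Rightarrow> int) \<Rightarrow> int \<Rightarrow> 'v mp \<Rightarrow> bool" where
  "wt_ge w d p \<longleftrightarrow> (\<forall>m\<in>Poly_Mapping.keys p. d \<le> wt w m)"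

lemma wt_superset:
  "finite A \<Longrightarrow> Poly_Mapping.keys m \<subseteq> A \<Longrightarrow> wt w m = (\<Sum>x\<in>A. w x * int (Poly_Mapping.lookup m x))"
  unfolding wt_def by (rule sum.mono_neutral_left) (auto simp: in_keys_iff)

lemma wt_add: "wt w (m + m') = wt w m + wt w m'"
  using Poly_Mapping.keys_add[of m m']
  by (simp add: wt_superset[of "Poly_Mapping.keys m \<union> Poly_Mapping.keys m'"] lookup_add
      distrib_left sum.distrib)

lemma wt_single: "wt w (Poly_Mapping.single x k) = w x * int k"
  by (cases "k = 0") (simp_all add: wt_def)

lemma wt_uminus: "wt (\<lambda>x. - w x) m = - wt w m"
  by (simp add: wt_def sum_negf)

lemma wt_ge_const: "wt_ge w 0 (mp_const c)"
  by (simp add: wt_ge_def mp_const_def wt_def)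

lemma wt_ge_zero [simp]: "wt_ge w d 0"
  by (simp add: wt_ge_def)

lemma wt_ge_add: "wt_ge w d p \<Longrightarrow> wt_ge w d q \<Longrightarrow> wt_ge w d (p + q)"
  using Poly_Mapping.keys_add[of p q] by (auto simp: wt_ge_def)

lemma wt_ge_sum: "(\<And>i. i \<in> I \<Longrightarrow> wt_ge w d (f i)) \<Longrightarrow> wt_ge w d (sum f I)"
  by (induction I rule: infinite_finite_induct) (auto intro: wt_ge_add)

lemma wt_ge_mult: "wt_ge w d p \<Longrightarrow> wt_ge w e q \<Longrightarrow> wt_ge w (d + e) (p * q)"
  using keys_mult[of p q] by (fastforce simp: wt_ge_def wt_add)

lemma wt_ge_deriv: "wt_ge w d p \<Longrightarrow> wt_ge w (d - w x) (mp_deriv x p)"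
  unfolding wt_ge_def
proof
  fix m assume p: "\<forall>m\<in>Poly_Mapping.keys p. d \<le> wt w m" and "m \<in> Poly_Mapping.keys (mp_deriv x p)"
  then have "m + Poly_Mapping.single x 1 \<in> Poly_Mapping.keys p"
    by (auto simp: in_keys_iff lookup_mp_deriv)
  with p show "d - w x \<le> wt w m" by (fastforce simp: wt_add wt_single)
qed

lemma wt_pos:
  assumes "\<And>x. w x \<ge> 1"
  shows "wt w m \<ge> 0"
proof -
  have "0 \<le> w x" for x using assms[of x] by linarith
  then show ?thesis unfolding wt_def by (auto intro!: sum_nonneg)
qed


section \<open>The terms of the inversion formula\<close>

definition ag_coeff :: "(nat \<Rightarrow> nat mp) \<Rightarrow> nat \<Rightarrow> nat \<Rightarrow> nat mp \<Rightarrow> nat mp" where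
  "ag_coeff H N m g = mp_const (1 / fact m) * ag_op H N m g"

lemma ag_op_add: "ag_op H N m (g + g') = ag_op H N m g + ag_op H N m g'"
  by (induction m arbitrary: g g') (simp_all add: distrib_right sum.distrib)

lemma ag_op_const_mult: "ag_op H N m (mp_const c * g) = mp_const c * ag_op H N m g"
  by (induction m arbitrary: g) (simp_all add: mult.assoc sum_distrib_left)

lemma ag_op_in_ring:
  "g \<in> mp_ring V \<Longrightarrow> (\<And>j. j < N \<Longrightarrow> H j \<in> mp_ring V) \<Longrightarrow> ag_op H N m g \<in> mp_ring V"
  by (induction m arbitrary: g) (auto intro!: mp_ring_sum mp_ring_deriv mp_ring_mult)

lemma wt_ge_ag_op:
  assumes "\<And>j. j < N \<Longrightarrow> wt_ge w (w j + e) (H j)" and "wt_ge w d g"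
  shows "wt_ge w (d + int m * e) (ag_op H N m g)"
  using assms(2)
proof (induction m arbitrary: d g)
  case (Suc m)
  have "wt_ge w (d + int (Suc m) * e) (mp_deriv j (ag_op H N m (g * H j)))" if "j < N" for j
    using wt_ge_deriv[OF Suc.IH[OF wt_ge_mult[OF Suc.prems assms(1)[OF that]]], of j]
    by (simp add: algebra_simps)
  then show ?case by (auto intro: wt_ge_sum)
qed simp

lemma ag_coeff_0 [simp]: "ag_coeff H N 0 g = g"
  by (simp add: ag_coeff_def)

lemma ag_coeff_add: "ag_coeff H N m (g + g') = ag_coeff H N m g + ag_coeff H N m g'"
  by (simp add: ag_coeff_def ag_op_add distrib_left)

lemma ag_coeff_const_mult: "ag_coeff H N m (mp_const c * g) = mp_const c * ag_coeff H N m g"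
  by (simp add: ag_coeff_def ag_op_const_mult mult.left_commute)

lemma ag_coeff_zero [simp]: "ag_coeff H N m 0 = 0"
  using ag_coeff_const_mult[of H N m 0 0] by simp

lemma ag_coeff_uminus: "ag_coeff H N m (- g) = - ag_coeff H N m g"
  using ag_coeff_add[of H N m g "- g"] by (simp add: eq_neg_iff_add_eq_0 add.commute)

lemma ag_coeff_diff: "ag_coeff H N m (g - g') = ag_coeff H N m g - ag_coeff H N m g'"
  using ag_coeff_add[of H N m g "- g'"] by (simp add: ag_coeff_uminus)

lemma ag_coeff_sum: "ag_coeff H N m (sum f I) = (\<Sum>i\<in>I. ag_coeff H N m (f i))"
  by (induction I rule: infinite_finite_induct) (simp_all add: ag_coeff_add)

lemma ag_coeff_in_ring:
  "g \<in> mp_ring V \<Longrightarrow> (\<And>j. j < N \<Longrightarrow> H j \<in> mp_ring V) \<Longrightarrow> ag_coeff H N m g \<in> mp_ring V"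
  by (simp add: ag_coeff_def ag_op_in_ring)

lemma wt_ge_ag_coeff:
  assumes "\<And>j. j < N \<Longrightarrow> wt_ge w (w j + e) (H j)" and "wt_ge w d g"
  shows "wt_ge w (d + int m * e) (ag_coeff H N m g)"
  using wt_ge_mult[OF wt_ge_const wt_ge_ag_op[OF assms]] by (simp add: ag_coeff_def)

text \<open>Moving \<open>z\<^sub>i\<close> out past \<open>m + 1\<close> derivatives costs a commutator with each of them that is \<open>\<partial>\<^sub>i\<close>, and it
  uses up the factor \<open>H\<^sub>i\<close> belonging to that derivative.  After division by \<open>m!\<close> and summation this
  says that the total operator \<open>A\<close> satisfies \<open>A ((z\<^sub>i - H\<^sub>i) g) = z\<^sub>i A g\<close>.\<close>

lemma ag_op_var_mult:
  assumes "\<And>k. k \<ge> N \<Longrightarrow> H k = 0"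
  shows "ag_op H N (Suc m) (mp_var i * g) =
    mp_var i * ag_op H N (Suc m) g + mp_const (of_nat (Suc m)) * ag_op H N m (H i * g)"
proof (induction m arbitrary: g)
  case 0
  have "(\<Sum>j<N. if i = j then g * H j else 0) = H i * g"
    using assms[of i] by (auto simp: mult.commute)
  then show ?case
    by (simp add: mult.assoc mp_deriv_var_mult sum.distrib sum_distrib_left eq_commute[of _ i] add.commute)
next
  case (Suc m)
  let ?B = "ag_op H N"
  have delta: "(\<Sum>j<N. if i = j then ?B (Suc m) (g * H j) else 0) = ?B (Suc m) (H i * g)"
    using assms[of i] ag_op_const_mult[of H N "Suc m" 0 0] by (auto simp: mult.commute simp del: ag_op.simps)
  have "?B (Suc (Suc m)) (mp_var i * g) = (\<Sum>j<N. mp_deriv j (?B (Suc m) (mp_var i * (g * H j))))"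
    by (subst ag_op.simps) (simp only: mult.assoc)
  also have "\<dots> = (\<Sum>j<N. mp_deriv j (mp_var i * ?B (Suc m) (g * H j)
      + mp_const (of_nat (Suc m)) * ?B m (H i * g * H j)))"
    by (simp only: Suc.IH mult.assoc)
  also have "\<dots> = (\<Sum>j<N. if i = j then ?B (Suc m) (g * H j) else 0)
      + mp_var i * (\<Sum>j<N. mp_deriv j (?B (Suc m) (g * H j)))
      + mp_const (of_nat (Suc m)) * (\<Sum>j<N. mp_deriv j (?B m (H i * g * H j)))"
    by (simp only: mp_deriv_add mp_deriv_var_mult mp_deriv_const_mult sum.distrib
        sum_distrib_left eq_commute[of _ i])
  also have "\<dots> = ?B (Suc m) (H i * g) + mp_var i * ?B (Suc (Suc m)) g
      + mp_const (of_nat (Suc m)) * ?B (Suc m) (H i * g)"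
    by (simp only: delta ag_op.simps(2)[of H N "Suc m" g] ag_op.simps(2)[of H N m "H i * g"])
  also have "\<dots> = mp_var i * ?B (Suc (Suc m)) g + mp_const (of_nat (Suc (Suc m))) * ?B (Suc m) (H i * g)"
    by (simp only: of_nat_Suc[of "Suc m"] mp_const.hom_add mp_const.hom_one distrib_right
        mult_1_left add_ac)
  finally show ?case .
qed

text \<open>The Leibniz rule for \<open>\<partial>\<^sub>i\<close> applied to \<open>g H\<^sub>j\<^sub>1 \<dots> H\<^sub>j\<^sub>m\<close>.  After division by \<open>m!\<close> and summation it reads
  \<open>A (\<partial>\<^sub>i g) = \<Sum>\<^sub>j \<partial>\<^sub>j A (g \<partial>\<^sub>i (z\<^sub>j - H\<^sub>j))\<close>.\<close>

lemma mp_deriv_ag_op: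
  "mp_deriv i (ag_op H N (Suc m) g) = ag_op H N (Suc m) (mp_deriv i g)
    + mp_const (of_nat (Suc m)) * (\<Sum>j<N. mp_deriv j (ag_op H N m (g * mp_deriv i (H j))))"
proof (induction m arbitrary: g)
  case 0
  show ?case
    by (simp add: mp_deriv_sum mp_deriv_commute[of i] mp_deriv_mult sum.distrib)
next
  case (Suc m)
  let ?B = "ag_op H N"
  have "mp_deriv i (?B (Suc (Suc m)) g) = (\<Sum>j<N. mp_deriv j (mp_deriv i (?B (Suc m) (g * H j))))"
    by (subst ag_op.simps) (simp only: mp_deriv_sum mp_deriv_commute[of i])
  also have "\<dots> = (\<Sum>j<N. mp_deriv j (?B (Suc m) (mp_deriv i g * H j)))
      + (\<Sum>j<N. mp_deriv j (?B (Suc m) (g * mp_deriv i (H j))))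
      + mp_const (of_nat (Suc m)) *
        (\<Sum>j<N. mp_deriv j (\<Sum>l<N. mp_deriv l (?B m (g * H j * mp_deriv i (H l)))))"
    by (simp only: Suc.IH mp_deriv_mult[of i g] ag_op_add mp_deriv_add mp_deriv_const_mult sum.distrib)
       (simp only: sum_distrib_left)
  also have "(\<Sum>j<N. mp_deriv j (\<Sum>l<N. mp_deriv l (?B m (g * H j * mp_deriv i (H l))))) =
      (\<Sum>l<N. mp_deriv l (\<Sum>j<N. mp_deriv j (?B m (g * mp_deriv i (H l) * H j))))"
    unfolding mp_deriv_sum by (subst sum.swap) (simp only: mp_deriv_commute mult_ac)
  also have "\<dots> = (\<Sum>l<N. mp_deriv l (?B (Suc m) (g * mp_deriv i (H l))))"
    by (simp only: ag_op.simps)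
  also have "(\<Sum>j<N. mp_deriv j (?B (Suc m) (mp_deriv i g * H j))) = ?B (Suc (Suc m)) (mp_deriv i g)"
    by (simp only: ag_op.simps)
  finally show ?case
    by (simp only: of_nat_Suc[of "Suc m"] mp_const.hom_add mp_const.hom_one distrib_right
        mult_1_left add_ac)
qed

lemma ag_coeff_var_mult:
  assumes "\<And>k. k \<ge> N \<Longrightarrow> H k = 0"
  shows "ag_coeff H N (Suc m) (mp_var i * g) = mp_var i * ag_coeff H N (Suc m) g + ag_coeff H N m (H i * g)"
proof -
  have op: "ag_op H N (Suc m) (mp_var i * g) =
      mp_var i * ag_op H N (Suc m) g + mp_const (of_nat (Suc m)) * ag_op H N m (H i * g)"
    by (rule ag_op_var_mult) (use assms in auto)
  show ?thesis
    unfolding ag_coeff_def op distrib_left const_fact_Suc by (simp only: mult.left_commute)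
qed

lemma mp_deriv_ag_coeff:
  "mp_deriv i (ag_coeff H N (Suc m) g) = ag_coeff H N (Suc m) (mp_deriv i g)
    + (\<Sum>j<N. mp_deriv j (ag_coeff H N m (g * mp_deriv i (H j))))"
  unfolding ag_coeff_def mp_deriv_const_mult mp_deriv_ag_op distrib_left const_fact_Suc
  by (simp only: sum_distrib_left)

text \<open>Let \<open>C\<close> be the inverse Jacobian matrix of \<open>z - H\<close>, with divergence-free columns; the hypothesis
  \<open>inv\<close> says \<open>(JH) C = C - I\<close>.  Formally, \<open>\<partial>\<^sub>k A 1 = A (\<Sum>\<^sub>i \<partial>\<^sub>i C\<^sub>i\<^sub>k) = 0\<close> for the total operator \<open>A\<close>, so
  \<open>A 1\<close> is constant.  Since \<open>H\<close> raises weights by exactly 1, the terms of \<open>A 1\<close> have pairwise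
  different weights and vanish one by one.  The infinite sum \<open>A\<close> is avoided by cutting it off:
  the remainder \<open>S M\<close> has weights growing with \<open>M\<close> and cannot cancel a fixed term.\<close>

lemma ag_coeff_one:
  fixes w :: "nat \<Rightarrow> int"
  assumes w: "\<And>x. w x \<ge> 1"
    and H: "\<And>j. j < N \<Longrightarrow> H j \<in> mp_ring {..<N}"
    and hom: "\<And>j m. j < N \<Longrightarrow> m \<in> Poly_Mapping.keys (H j) \<Longrightarrow> wt w m = w j + 1"
    and inv: "\<And>j k. j < N \<Longrightarrow> k < N \<Longrightarrow>
      (\<Sum>i<N. C i k * mp_deriv i (H j)) = C j k - (if j = k then 1 else 0)"
    and div: "\<And>k. k < N \<Longrightarrow> (\<Sum>i<N. mp_deriv i (C i k)) = 0"
    and "m0 \<ge> 1"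
  shows "ag_coeff H N m0 1 = 0"
proof (rule ccontr)
  let ?A = "ag_coeff H N"
  assume "?A m0 1 \<noteq> 0"
  then obtain \<kappa> where \<kappa>: "\<kappa> \<in> Poly_Mapping.keys (?A m0 1)"
    by (metis mp_nonzero_key)
  have one: "wt_ge v 0 (1 :: nat mp)" for v
    using wt_ge_const[of v 1] by simp
  \<comment> \<open>The order bound for the weights \<open>w\<close> and \<open>- w\<close> gives equality.\<close>
  have homA: "wt w \<mu> = int m" if "\<mu> \<in> Poly_Mapping.keys (?A m 1)" for \<mu> m
  proof -
    have "wt_ge w (0 + int m * 1) (?A m 1)"
      by (rule wt_ge_ag_coeff[OF _ one]) (use hom in \<open>auto simp: wt_ge_def\<close>)
    moreover have "wt_ge (\<lambda>x. - w x) (0 + int m * (- 1)) (?A m 1)"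
      by (rule wt_ge_ag_coeff[OF _ one]) (use hom in \<open>auto simp: wt_ge_def wt_uminus\<close>)
    ultimately show ?thesis using that by (force simp: wt_ge_def wt_uminus)
  qed
  have "\<kappa> \<noteq> 0" using homA[OF \<kappa>] \<open>m0 \<ge> 1\<close> by (auto simp: wt_def)
  then obtain k where k: "k \<in> Poly_Mapping.keys \<kappa>"
    by (metis mp_nonzero_key)
  have "?A m0 1 \<in> mp_ring {..<N}" by (rule ag_coeff_in_ring) (use H in auto)
  then have kN: "k < N" using \<kappa> k by (auto simp: mp_ring_def)
  define \<nu> where "\<nu> = \<kappa> - Poly_Mapping.single k 1"
  have \<nu>: "\<nu> + Poly_Mapping.single k 1 = \<kappa>"
    by (rule poly_mapping_eqI)
       (use k in \<open>auto simp: \<nu>_def lookup_add lookup_minus lookup_single when_def in_keys_iff\<close>)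

  define S where "S m = (\<Sum>i<N. mp_deriv i (?A m (C i k)))" for m
  have S_Suc: "S (Suc m) = S m - mp_deriv k (?A m 1)" for m
  proof -
    have "S (Suc m) = (\<Sum>i<N. ?A (Suc m) (mp_deriv i (C i k)))
        + (\<Sum>i<N. \<Sum>j<N. mp_deriv j (?A m (C i k * mp_deriv i (H j))))"
      by (simp add: S_def mp_deriv_ag_coeff sum.distrib)
    also have "(\<Sum>i<N. ?A (Suc m) (mp_deriv i (C i k))) = 0"
      using div[OF kN] by (simp flip: ag_coeff_sum)
    also have "(\<Sum>i<N. \<Sum>j<N. mp_deriv j (?A m (C i k * mp_deriv i (H j)))) =
        (\<Sum>j<N. mp_deriv j (?A m (\<Sum>i<N. C i k * mp_deriv i (H j))))"
      by (subst sum.swap) (simp add: ag_coeff_sum mp_deriv_sum)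
    also have "\<dots> = (\<Sum>j<N. mp_deriv j (?A m (C j k)) - (if j = k then mp_deriv j (?A m 1) else 0))"
      by (rule sum.cong) (use inv kN in \<open>auto simp: ag_coeff_diff\<close>)
    finally show ?thesis using kN by (simp add: S_def sum_subtractf)
  qed
  have S_sum: "S M = - (\<Sum>m<M. mp_deriv k (?A m 1))" for M
  proof (induction M)
    case 0
    show ?case using div[OF kN] by (simp add: S_def)
  qed (simp add: S_Suc)

  \<comment> \<open>Large enough that even after a derivative every monomial of \<open>S M\<close> outweighs \<open>\<nu>\<close>.\<close>
  define M where "M = Suc m0 + nat (\<Sum>i<N. w i)"
  have coeff: "Poly_Mapping.lookup (mp_deriv k (?A m 1)) \<nu> =
      (if m = m0 then of_nat (Poly_Mapping.lookup \<nu> k + 1) * Poly_Mapping.lookup (?A m0 1) \<kappa> else 0)" for m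
  proof (cases "m = m0")
    case False
    then have "\<kappa> \<notin> Poly_Mapping.keys (?A m 1)" using homA[OF \<kappa>] homA[of \<kappa> m] by auto
    then show ?thesis using False by (simp add: lookup_mp_deriv \<nu> in_keys_iff del: One_nat_def)
  qed (simp add: lookup_mp_deriv \<nu> del: One_nat_def)
  have "Poly_Mapping.lookup (S M) \<nu> = - (of_nat (Poly_Mapping.lookup \<nu> k + 1) * Poly_Mapping.lookup (?A m0 1) \<kappa>)"
    unfolding S_sum by (simp only: lookup_uminus lookup_sum coeff) (simp add: M_def)
  moreover have "of_nat (Poly_Mapping.lookup \<nu> k + 1) \<noteq> (0 :: complex)"
    by (simp only: of_nat_eq_0_iff)
  ultimately have "\<nu> \<in> Poly_Mapping.keys (S M)"
    using \<kappa> by (simp add: in_keys_iff del: of_nat_add)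
  moreover have "wt_ge w (int M - (\<Sum>i<N. w i)) (S M)"
    unfolding S_def
  proof (rule wt_ge_sum)
    fix i assume i: "i \<in> {..<N}"
    have "wt_ge w (0 + int M * 1) (?A M (C i k))"
      by (rule wt_ge_ag_coeff) (use hom wt_pos[OF w] in \<open>auto simp: wt_ge_def\<close>)
    from wt_ge_deriv[OF this, of i] have "wt_ge w (int M - w i) (mp_deriv i (?A M (C i k)))" by simp
    moreover have "w i \<le> (\<Sum>i<N. w i)"
      using i w by (intro member_le_sum) (auto intro: order_trans[of 0 1])
    ultimately show "wt_ge w (int M - (\<Sum>i<N. w i)) (mp_deriv i (?A M (C i k)))"
      by (force simp: wt_ge_def)
  qed
  ultimately have "int M - (\<Sum>i<N. w i) \<le> wt w \<nu>" by (simp add: wt_ge_def)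
  moreover have "wt w \<nu> = int m0 - w k"
    using homA[OF \<kappa>] by (simp add: wt_add wt_single flip: \<nu>)
  moreover have "(\<Sum>i<N. w i) \<ge> 0"
    using w by (intro sum_nonneg) (auto intro: order_trans[of 0 1])
  ultimately show False using w[of k] by (simp add: M_def)
qed

text \<open>When every series \<open>A g\<close> terminates, \<open>A\<close> is a two-sided inverse of the substitution
  \<open>p \<mapsto> p (z - H)\<close>.  It is a left inverse because \<open>A (p (z - H) g) = p A g\<close> and \<open>A 1 = 1\<close>; it is
  injective because the part of \<open>A g\<close> of lowest weight is that of \<open>g\<close>.\<close>

context
  fixes H :: "nat \<Rightarrow> nat mp" and N :: nat and w :: "nat \<Rightarrow> int"
  assumes w: "\<And>x. w x \<ge> 1"
    and H0: "\<And>k. k \<ge> N \<Longrightarrow> H k = 0"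
    and hom: "\<And>j m. j < N \<Longrightarrow> m \<in> Poly_Mapping.keys (H j) \<Longrightarrow> wt w m = w j + 1"
    and one: "\<And>m. m \<ge> 1 \<Longrightarrow> ag_coeff H N m 1 = 0"
    and eventually_zero: "\<And>g. \<exists>M. \<forall>m\<ge>M. ag_coeff H N m g = 0"
begin

definition ag_total :: "nat mp \<Rightarrow> nat mp" where
  "ag_total g = Sum_any (\<lambda>m. ag_coeff H N m g)"

lemma ag_total_eq_sum: "\<exists>M0. \<forall>M\<ge>M0. ag_total g = (\<Sum>m<M. ag_coeff H N m g)"
proof -
  obtain M0 where "\<forall>m\<ge>M0. ag_coeff H N m g = 0" using eventually_zero by blast
  then have "ag_total g = (\<Sum>m<M. ag_coeff H N m g)" if "M \<ge> M0" for M
    unfolding ag_total_def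
    by (intro Sum_any.expand_superset) (use that in \<open>auto simp: not_le[symmetric]\<close>)
  then show ?thesis by blast
qed

lemma ag_total_add: "ag_total (g + g') = ag_total g + ag_total g'"
proof -
  obtain M1 M2 M3 where "\<forall>M\<ge>M1. ag_total g = (\<Sum>m<M. ag_coeff H N m g)"
      "\<forall>M\<ge>M2. ag_total g' = (\<Sum>m<M. ag_coeff H N m g')"
      "\<forall>M\<ge>M3. ag_total (g + g') = (\<Sum>m<M. ag_coeff H N m (g + g'))"
    using ag_total_eq_sum by meson
  then have "ag_total g = (\<Sum>m<M1+M2+M3. ag_coeff H N m g)"
      "ag_total g' = (\<Sum>m<M1+M2+M3. ag_coeff H N m g')"
      "ag_total (g + g') = (\<Sum>m<M1+M2+M3. ag_coeff H N m (g + g'))"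
    by (meson le_add1 le_add2 order_trans)+
  then show ?thesis by (simp add: ag_coeff_add sum.distrib)
qed

lemma ag_total_const_mult: "ag_total (mp_const c * g) = mp_const c * ag_total g"
proof -
  obtain M1 M2 where "\<forall>M\<ge>M1. ag_total g = (\<Sum>m<M. ag_coeff H N m g)"
      "\<forall>M\<ge>M2. ag_total (mp_const c * g) = (\<Sum>m<M. ag_coeff H N m (mp_const c * g))"
    using ag_total_eq_sum by meson
  then have "ag_total g = (\<Sum>m<M1+M2. ag_coeff H N m g)"
      "ag_total (mp_const c * g) = (\<Sum>m<M1+M2. ag_coeff H N m (mp_const c * g))"
    by (meson le_add1 le_add2 order_trans)+
  then show ?thesis by (simp add: ag_coeff_const_mult sum_distrib_left)
qed

lemma ag_total_diff: "ag_total (g - g') = ag_total g - ag_total g'"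
  using ag_total_add[of "g - g'" g'] by simp

lemma ag_total_one: "ag_total 1 = 1"
proof -
  obtain M where "ag_total 1 = (\<Sum>m<Suc M. ag_coeff H N m 1)"
    using ag_total_eq_sum[of 1] le_Suc_eq by blast
  also have "\<dots> = 1" unfolding sum.lessThan_Suc_shift using one by simp
  finally show ?thesis .
qed

lemma ag_total_var_mult: "ag_total ((mp_var i - H i) * g) = mp_var i * ag_total g"
proof -
  obtain M1 M2 M3 where "\<forall>M\<ge>M1. ag_total g = (\<Sum>m<M. ag_coeff H N m g)"
      "\<forall>M\<ge>M2. ag_total (H i * g) = (\<Sum>m<M. ag_coeff H N m (H i * g))"
      "\<forall>M\<ge>M3. ag_total (mp_var i * g) = (\<Sum>m<M. ag_coeff H N m (mp_var i * g))"
    using ag_total_eq_sum by meson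
  moreover define M where "M = M1+M2+M3"
  ultimately have eqs: "ag_total g = (\<Sum>m<Suc M. ag_coeff H N m g)"
      "ag_total (H i * g) = (\<Sum>m<M. ag_coeff H N m (H i * g))"
      "ag_total (mp_var i * g) = (\<Sum>m<Suc M. ag_coeff H N m (mp_var i * g))"
    by (auto simp del: sum.lessThan_Suc)
  have "ag_total (mp_var i * g) = mp_var i * ag_total g + ag_total (H i * g)"
    unfolding eqs sum.lessThan_Suc_shift
    by (simp add: ag_coeff_var_mult[of N H, OF H0] sum.distrib sum_distrib_left distrib_left)
  then show ?thesis by (simp add: left_diff_distrib ag_total_diff)
qed

lemma ag_total_subst_mult: "ag_total (mp_subst (\<lambda>k. mp_var k - H k) p * g) = p * ag_total g"
proof (induction p arbitrary: g rule: mp_induct)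
  case (var x p)
  have "ag_total (mp_subst (\<lambda>k. mp_var k - H k) (mp_var x * p) * g) =
      ag_total ((mp_var x - H x) * (mp_subst (\<lambda>k. mp_var k - H k) p * g))"
    by (simp add: subst_hom.hom_mult mult.assoc)
  then show ?case by (simp add: ag_total_var_mult var mult.assoc)
qed (simp_all add: ag_total_const_mult ag_total_add subst_hom.hom_add distrib_right)

lemma ag_total_subst: "ag_total (mp_subst (\<lambda>k. mp_var k - H k) p) = p"
  using ag_total_subst_mult[of p 1] by (simp add: ag_total_one)

lemma ag_total_eq_0_imp:
  assumes "ag_total g = 0"
  shows "g = 0"
proof (rule ccontr)
  assume "g \<noteq> 0"
  then have "Poly_Mapping.keys g \<noteq> {}" by (metis mp_nonzero_key equals0D)
  then obtain \<kappa> where \<kappa>: "\<kappa> \<in> Poly_Mapping.keys g" "wt_ge w (wt w \<kappa>) g"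
    using ex_min_if_finite[of "wt w ` Poly_Mapping.keys g"]
    by (auto simp: wt_ge_def not_less)
  obtain M where M: "ag_total g = (\<Sum>m<Suc M. ag_coeff H N m g)"
    using ag_total_eq_sum[of g] le_Suc_eq by blast
  have "Poly_Mapping.lookup (ag_coeff H N (Suc m) g) \<kappa> = 0" for m
  proof -
    have "wt_ge w (wt w \<kappa> + int (Suc m) * 1) (ag_coeff H N (Suc m) g)"
      by (rule wt_ge_ag_coeff[OF _ \<kappa>(2)]) (use hom in \<open>auto simp: wt_ge_def\<close>)
    then have "\<kappa> \<notin> Poly_Mapping.keys (ag_coeff H N (Suc m) g)" by (auto simp: wt_ge_def)
    then show ?thesis by (simp add: in_keys_iff)
  qed
  then have "Poly_Mapping.lookup (ag_total g) \<kappa> = Poly_Mapping.lookup g \<kappa>"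
    unfolding M sum.lessThan_Suc_shift by (simp add: lookup_add lookup_sum)
  with assms \<kappa>(1) show False by (simp add: in_keys_iff)
qed

lemma subst_ag_total: "mp_subst (\<lambda>k. mp_var k - H k) (ag_total g) = g"
proof -
  have "ag_total (mp_subst (\<lambda>k. mp_var k - H k) (ag_total g) - g) = 0"
    by (simp add: ag_total_diff ag_total_subst)
  from ag_total_eq_0_imp[OF this] show ?thesis by simp
qed

lemma polynomial_inverse_exists:
  "\<exists>G. (\<forall>k. mp_subst (\<lambda>k. mp_var k - H k) (G k) = mp_var k) \<and> (\<forall>k. mp_subst G (mp_var k - H k) = mp_var k)"
proof (intro exI conjI allI)
  let ?\<Phi> = "\<lambda>k. mp_var k - H k" and ?G = "\<lambda>k. ag_total (mp_var k)"
  show inv: "mp_subst ?\<Phi> (?G k) = mp_var k" for k by (rule subst_ag_total)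
  fix k
  have "mp_subst ?\<Phi> (mp_subst ?G (?\<Phi> k)) = ?\<Phi> k"
    by (simp add: mp_subst_subst inv del: mp_subst_simps)
  then have "ag_total (mp_subst ?\<Phi> (mp_subst ?G (?\<Phi> k))) = ag_total (mp_subst ?\<Phi> (mp_var k))"
    by simp
  then show "mp_subst ?G (?\<Phi> k) = mp_var k" by (simp only: ag_total_subst)
qed

end


section \<open>The derivative of a determinant and the Piola identity\<close>

lemma mp_deriv_prod:
  assumes "finite I"
  shows "mp_deriv x (prod f I) = (\<Sum>a\<in>I. mp_deriv x (f a) * prod f (I - {a}))"
  using assms
proof (induction I rule: finite_induct)
  case (insert b I)
  have "prod f (insert b I - {a}) = f b * prod f (I - {a})" if "a \<in> I" for a
    using that insert.hyps by (subst insert_Diff_if) auto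
  then have "(\<Sum>a\<in>I. mp_deriv x (f a) * prod f (insert b I - {a})) =
      f b * (\<Sum>a\<in>I. mp_deriv x (f a) * prod f (I - {a}))"
    by (simp add: sum_distrib_left mult.left_commute)
  with insert show ?case by (simp add: mp_deriv_mult)
qed simp

lemma mp_deriv_signof_mult: "mp_deriv x (signof p * q) = signof p * mp_deriv x q"
  by (cases "sign p = 1") (auto simp: sign_def)

text \<open>Jacobi's formula.  Differentiating one row at a time gives determinants of matrices that
  agree with \<open>A\<close> outside that row, hence have the same cofactors along it.\<close>

lemma mp_deriv_det:
  assumes A: "A \<in> carrier_mat n n"
  shows "mp_deriv x (det A) = (\<Sum>a<n. \<Sum>i<n. mp_deriv x (A $$ (a, i)) * cofactor A a i)"
proof -
  define R where "R a = mat n n (\<lambda>(i, j). if i = a then mp_deriv x (A $$ (a, j)) else A $$ (i, j))" for a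
  have R: "R a \<in> carrier_mat n n" for a by (simp add: R_def)
  have "mp_deriv x (det A) = (\<Sum>p\<in>{p. p permutes {0..<n}}. signof p *
      (\<Sum>a\<in>{0..<n}. mp_deriv x (A $$ (a, p a)) * (\<Prod>i\<in>{0..<n} - {a}. A $$ (i, p i))))"
    unfolding det_def'[OF A] mp_deriv_sum mp_deriv_signof_mult by (simp add: mp_deriv_prod)
  also have "\<dots> = (\<Sum>a\<in>{0..<n}. \<Sum>p\<in>{p. p permutes {0..<n}}. signof p *
      (mp_deriv x (A $$ (a, p a)) * (\<Prod>i\<in>{0..<n} - {a}. A $$ (i, p i))))"
    unfolding sum_distrib_left by (rule sum.swap)
  also have "\<dots> = (\<Sum>a\<in>{0..<n}. det (R a))"
    unfolding det_def'[OF R]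
  proof (intro sum.cong refl, goal_cases)
    case (1 a p)
    then have p: "\<And>i. i < n \<Longrightarrow> p i < n" using permutes_in_image by fastforce
    have "(\<Prod>i = 0..<n. R a $$ (i, p i)) = R a $$ (a, p a) * (\<Prod>i\<in>{0..<n} - {a}. R a $$ (i, p i))"
      using 1 by (intro prod.remove) auto
    also have "\<dots> = mp_deriv x (A $$ (a, p a)) * (\<Prod>i\<in>{0..<n} - {a}. A $$ (i, p i))"
      using 1 p by (intro arg_cong2[of _ _ _ _ "(*)"] prod.cong) (auto simp: R_def)
    finally show ?case by simp
  qed
  also have "\<dots> = (\<Sum>a\<in>{0..<n}. \<Sum>i<n. mp_deriv x (A $$ (a, i)) * cofactor A a i)"
  proof (rule sum.cong[OF refl])
    fix a assume a: "a \<in> {0..<n}"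
    have del: "mat_delete (R a) a i = mat_delete A a i" if "i < n" for i
      by (rule eq_matI) (use A a that in \<open>auto simp: mat_delete_def R_def\<close>)
    have "det (R a) = (\<Sum>i<n. R a $$ (a, i) * cofactor (R a) a i)"
      by (rule laplace_expansion_row[OF R]) (use a in auto)
    also have "\<dots> = (\<Sum>i<n. mp_deriv x (A $$ (a, i)) * cofactor A a i)"
      by (rule sum.cong) (use a in \<open>auto simp: cofactor_def del\<close>, auto simp: R_def)
    finally show "det (R a) = \<dots>" .
  qed
  finally show ?thesis by (simp add: lessThan_atLeast0)
qed

text \<open>With \<open>K\<close> the inverse of the Jacobian matrix \<open>M\<close>, differentiating \<open>K M = I\<close> gives for the column
  divergences \<open>d\<close> of \<open>K\<close> that \<open>(d M)\<^sub>j = - \<Sum>\<^sub>i\<^sub>,\<^sub>a K\<^sub>i\<^sub>a \<partial>\<^sub>i \<partial>\<^sub>j F\<^sub>a\<close>.  By the symmetry of second derivatives and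
  Jacobi's formula this is \<open>- \<partial>\<^sub>j (det M)\<close> over \<open>det M\<close>, which is zero.\<close>

lemma inverse_jacobian_divergence_free:
  assumes F: "poly_tuple n F" and det: "det (jacobian_matrix n F) = mp_const c" and c: "c \<noteq> 0"
  obtains K :: "nat \<Rightarrow> nat \<Rightarrow> nat mp" where
    "\<And>j k. j < n \<Longrightarrow> k < n \<Longrightarrow> (\<Sum>i<n. mp_deriv i (F j) * K i k) = (if j = k then 1 else 0)"
    "\<And>i j. i < n \<Longrightarrow> j < n \<Longrightarrow> (\<Sum>a<n. K i a * mp_deriv j (F a)) = (if i = j then 1 else 0)"
    "\<And>k. k < n \<Longrightarrow> (\<Sum>i<n. mp_deriv i (K i k)) = 0"
    "\<And>x i k. i < n \<Longrightarrow> k < n \<Longrightarrow> x \<ge> n \<Longrightarrow> mp_deriv x (K i k) = 0"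
proof -
  let ?M = "jacobian_matrix n F"
  define K where "K i k = mp_const (1 / c) * cofactor ?M k i" for i k
  have M: "?M \<in> carrier_mat n n" by (simp add: jacobian_matrix_def)
  have dims: "dim_row ?M = n" "dim_col ?M = n" using M by auto
  have entry: "?M $$ (i, j) = mp_deriv j (F i)" if "i < n" "j < n" for i j
    using that by (simp add: jacobian_matrix_def)
  have scale: "mp_const (1 / c) * mp_const c = 1"
    using c by (simp flip: mp_const.hom_mult)
  have MK: "(\<Sum>i<n. mp_deriv i (F j) * K i k) = (if j = k then 1 else 0)" if "j < n" "k < n" for j k
  proof -
    have "(\<Sum>i<n. mp_deriv i (F j) * cofactor ?M k i) = (?M * adj_mat ?M) $$ (j, k)"
      using that by (simp add: adj_mat_def scalar_prod_def dims entry lessThan_atLeast0)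
    also have "\<dots> = mp_const c * (if j = k then 1 else 0)"
      unfolding adj_mat(2)[OF M] det using that by simp
    finally show ?thesis
      using scale by (auto simp: K_def mult.left_commute[of _ "mp_const (1 / c)"] simp flip: sum_distrib_left)
  qed
  have KM: "(\<Sum>a<n. K i a * mp_deriv j (F a)) = (if i = j then 1 else 0)" if "i < n" "j < n" for i j
  proof -
    have "(\<Sum>a<n. cofactor ?M a i * mp_deriv j (F a)) = (adj_mat ?M * ?M) $$ (i, j)"
      using that by (simp add: adj_mat_def scalar_prod_def dims entry lessThan_atLeast0)
    also have "\<dots> = mp_const c * (if i = j then 1 else 0)"
      unfolding adj_mat(3)[OF M] det using that by simp
    finally show ?thesis
      using scale by (auto simp: K_def mult.assoc simp flip: sum_distrib_left)
  qed
  have trace: "(\<Sum>a<n. \<Sum>i<n. K i a * mp_deriv x (mp_deriv i (F a))) = 0" for x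
  proof -
    have "0 = mp_const (1 / c) * mp_deriv x (det ?M)" by (simp add: det)
    also have "\<dots> = (\<Sum>a<n. \<Sum>i<n. K i a * mp_deriv x (mp_deriv i (F a)))"
      unfolding mp_deriv_det[OF M] K_def by (simp add: sum_distrib_left entry mult_ac)
    finally show ?thesis by simp
  qed
  have div: "(\<Sum>i<n. mp_deriv i (K i k)) = 0" if k: "k < n" for k
  proof -
    define d where "d a = (\<Sum>i<n. mp_deriv i (K i a))" for a
    have dM: "(\<Sum>a<n. d a * mp_deriv j (F a)) = 0" if j: "j < n" for j
    proof -
      have "(\<Sum>a<n. mp_deriv i (K i a) * mp_deriv j (F a)) =
          - (\<Sum>a<n. K i a * mp_deriv i (mp_deriv j (F a)))" if i: "i < n" for i
      proof -
        have "0 = mp_deriv i (\<Sum>a<n. K i a * mp_deriv j (F a))" using KM[OF i j] by simp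
        also have "\<dots> = (\<Sum>a<n. mp_deriv i (K i a) * mp_deriv j (F a))
            + (\<Sum>a<n. K i a * mp_deriv i (mp_deriv j (F a)))"
          by (simp add: mp_deriv_sum mp_deriv_mult sum.distrib)
        finally show ?thesis by (simp add: eq_neg_iff_add_eq_0)
      qed
      then have "(\<Sum>i<n. \<Sum>a<n. mp_deriv i (K i a) * mp_deriv j (F a)) =
          - (\<Sum>i<n. \<Sum>a<n. K i a * mp_deriv i (mp_deriv j (F a)))"
        by (simp add: sum_negf)
      also have "(\<Sum>i<n. \<Sum>a<n. K i a * mp_deriv i (mp_deriv j (F a))) = 0"
        using trace[of j] by (subst sum.swap) (simp add: mp_deriv_commute[of j])
      finally show ?thesis
        unfolding d_def sum_distrib_right by (subst sum.swap) simp
    qed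
    \<comment> \<open>\<open>d M = 0\<close> implies \<open>d = 0\<close> because \<open>M\<close> is invertible.\<close>
    have "d k = (\<Sum>a<n. d a * (\<Sum>j<n. mp_deriv j (F a) * K j k))"
      using k by (simp add: MK if_distrib cong: if_cong)
    also have "\<dots> = (\<Sum>j<n. (\<Sum>a<n. d a * mp_deriv j (F a)) * K j k)"
      unfolding sum_distrib_left sum_distrib_right by (subst sum.swap) (simp add: mult.assoc)
    also have "\<dots> = 0" by (simp add: dM)
    finally show ?thesis by (simp add: d_def)
  qed
  have out: "mp_deriv x (K i k) = 0" if "i < n" "k < n" "x \<ge> n" for x i k
  proof -
    let ?D = "mat_delete ?M k i"
    have D: "?D \<in> carrier_mat (n - 1) (n - 1)" using M by (rule mat_delete_carrier)
    have "mp_deriv x (?D $$ (a, b)) = 0" if "a < n - 1" "b < n - 1" for a b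
    proof -
      have "mp_deriv x (mp_deriv j (F l)) = 0" if "l < n" for j l
        by (rule mp_deriv_outside[of _ "{..<n}"]) (use F that \<open>x \<ge> n\<close> in \<open>auto simp: poly_tuple_def\<close>)
      then show ?thesis using that by (auto simp: mat_delete_def dims entry)
    qed
    then have "mp_deriv x (det ?D) = 0" unfolding mp_deriv_det[OF D] by simp
    moreover have sgn: "(- 1) ^ (k + i) = mp_const ((- 1) ^ (k + i))"
      by (simp add: mp_const.hom_power mp_const.hom_uminus)
    ultimately show ?thesis unfolding K_def cofactor_def sgn mp_deriv_const_mult by simp
  qed
  show thesis by (rule that[of K]) (fact MK KM div out)+
qed


section \<open>Adding variables until the map is weighted homogeneous\<close>

text \<open>Here \<open>F = x - P\<^sub>0 - P\<^sub>1 - \<dots>\<close> with \<open>P\<^sub>j\<close> homogeneous of degree \<open>j + 2\<close>.  Introduce blocks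
  \<open>y\<^sub>0 = x, y\<^sub>1, \<dots>, y\<^sub>D\<^sub>-\<^sub>1\<close> of \<open>n\<close> variables each and let \<open>\<Phi>\<close> send \<open>y\<^sub>j\<close> to \<open>y\<^sub>j - P\<^sub>j(x) - y\<^sub>j\<^sub>+\<^sub>1\<close>, where \<open>y\<^sub>D = 0\<close>.  With weight
  \<open>j + 1\<close> on block \<open>j\<close>, every subtracted term has weight one more than \<open>y\<^sub>j\<close>.  The blocks of \<open>\<Phi>\<close> add up
  to \<open>F x\<close>, and all blocks but the first vanish for \<open>y\<^sub>j = \<Sum>\<^bsub>r \<ge> j\<^esub> P\<^sub>r(x)\<close>; so an inverse of \<open>\<Phi>\<close>,
  restricted to the points with only the first block nonzero, is one of \<open>F\<close>.  Component \<open>i\<close> of block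
  \<open>j\<close> is the variable \<open>j n + i\<close>.\<close>

lemma normalized_inverse:
  assumes mathieu: "\<forall>n\<ge>1. \<forall>t::complex. mathieu_subspace complex_ring (B_alg n t) (xi_subspace n)"
    and n: "n \<ge> 1" and D: "D \<ge> 1"
    and F: "\<And>i. i < n \<Longrightarrow> F i = mp_var i - (\<Sum>j<D. P j i)"
    and P: "\<And>j i. i < n \<Longrightarrow> P j i \<in> mp_ring {..<n}"
    and deg: "\<And>j i m. i < n \<Longrightarrow> m \<in> Poly_Mapping.keys (P j i) \<Longrightarrow> mono_deg m = j + 2"
    and MK: "\<And>j k. j < n \<Longrightarrow> k < n \<Longrightarrow> (\<Sum>i<n. mp_deriv i (F j) * K i k) = (if j = k then 1 else 0)"
    and div: "\<And>k. k < n \<Longrightarrow> (\<Sum>i<n. mp_deriv i (K i k)) = 0"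
    and out: "\<And>x i k. i < n \<Longrightarrow> k < n \<Longrightarrow> x \<ge> n \<Longrightarrow> mp_deriv x (K i k) = 0"
  obtains G :: "nat \<Rightarrow> nat mp" where
    "\<And>x i. i < n \<Longrightarrow> mp_value (\<lambda>k. if k < n then mp_value x (F k) else 0) (G i) = x i"
    "\<And>u i. i < n \<Longrightarrow> mp_value (\<lambda>k. mp_value (\<lambda>k. if k < n then u k else 0) (G k)) (F i) = u i"
proof -
  define N where "N = n * D"
  define H where "H k = (if k < N then P (k div n) (k mod n) + (if k + n < N then mp_var (k + n) else 0) else 0)" for k
  define w where "w k = int (k div n) + 1" for k
  define Q where "Q r i l = (\<Sum>a<n. mp_deriv a (P r i) * K a l)" for r i l
  \<comment> \<open>The block of row \<open>j\<close> of the inverse Jacobian matrix of \<open>\<Phi>\<close>, obtained by eliminating the \<open>y\<^sub>j\<close>.\<close>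
  define Cb where "Cb j i k = (if j \<le> k div n \<and> i = k mod n then 1 else 0) + (\<Sum>r=j..<D. Q r i (k mod n))" for j i k
  define C where "C i k = Cb (i div n) (i mod n) k" for i k
  have nN: "n \<le> N" using D by (simp add: N_def)
  have md: "k mod n < n" for k using n by simp
  have dv: "k div n < D \<longleftrightarrow> k < N" for k
    using n by (simp add: N_def div_less_iff_less_mult mult.commute)
  have dvn: "(k + n) div n = Suc (k div n)" "(k + n) mod n = k mod n" for k
    using n by auto
  have split_eq: "j = k \<longleftrightarrow> j div n = k div n \<and> j mod n = k mod n" for j k
    by (metis div_mult_mod_eq)

  \<comment> \<open>In the first block the \<open>Q r\<close> add up to \<open>(I - JF) K = K - I\<close>, which leaves just \<open>K\<close>.\<close>
  have C0: "C i k = K i (k mod n)" if "i < n" for i k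
  proof -
    have "(\<Sum>r<D. Q r i (k mod n)) = (\<Sum>a<n. mp_deriv a (\<Sum>r<D. P r i) * K a (k mod n))"
      unfolding Q_def mp_deriv_sum sum_distrib_right by (rule sum.swap)
    also have "\<dots> = (\<Sum>a<n. mp_deriv a (mp_var i - F i) * K a (k mod n))"
      using F[OF that] by simp
    also have "\<dots> = (\<Sum>a<n. (if a = i then K a (k mod n) else 0)) - (\<Sum>a<n. mp_deriv a (F i) * K a (k mod n))"
      unfolding sum_subtractf[symmetric]
      by (rule sum.cong) (auto simp: mp_deriv_var left_diff_distrib)
    also have "\<dots> = K i (k mod n) - (if i = k mod n then 1 else 0)"
      using that by (simp add: MK md)
    finally show ?thesis using that by (simp add: C_def Cb_def lessThan_atLeast0)
  qed
  have inv: "(\<Sum>i<N. C i k * mp_deriv i (H j)) = C j k - (if j = k then 1 else 0)"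
    if jk: "j < N" "k < N" for j k
  proof -
    let ?jb = "j div n" and ?ji = "j mod n"
    have "mp_deriv i (H j) = mp_deriv i (P ?jb ?ji) + (if i = j + n then 1 else 0)" if "i < N" for i
      using jk that by (auto simp: H_def mp_deriv_var)
    then have "(\<Sum>i<N. C i k * mp_deriv i (H j)) =
        (\<Sum>i<N. C i k * mp_deriv i (P ?jb ?ji)) + (\<Sum>i<N. if i = j + n then C i k else 0)"
      unfolding sum.distrib[symmetric] by (intro sum.cong) (auto simp: distrib_left)
    also have "(\<Sum>i<N. C i k * mp_deriv i (P ?jb ?ji)) = (\<Sum>i<n. C i k * mp_deriv i (P ?jb ?ji))"
      by (rule sum.mono_neutral_right)
         (use nN in \<open>auto simp: mp_deriv_outside[OF P[OF md]]\<close>)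
    also have "\<dots> = Q ?jb ?ji (k mod n)"
      by (simp add: C0 Q_def mult.commute)
    also have "(\<Sum>i<N. if i = j + n then C i k else 0) = Cb (Suc ?jb) ?ji k"
    proof (cases "j + n < N")
      case True
      then show ?thesis by (simp add: C_def dvn)
    next
      case False
      then have "\<not> Suc ?jb < D" using dv[of "j + n"] dvn by simp
      moreover have "k div n < D" using dv jk by simp
      ultimately show ?thesis using False by (simp add: Cb_def)
    qed
    also have "Q ?jb ?ji (k mod n) + Cb (Suc ?jb) ?ji k = C j k - (if j = k then 1 else 0)"
    proof -
      have "?jb < D" using dv jk by simp
      then have "(\<Sum>r=?jb..<D. Q r ?ji (k mod n)) = Q ?jb ?ji (k mod n) + (\<Sum>r=Suc ?jb..<D. Q r ?ji (k mod n))"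
        by (rule sum.atLeast_Suc_lessThan)
      moreover have "(if ?jb \<le> k div n \<and> ?ji = k mod n then 1 else (0 :: nat mp)) =
          (if Suc ?jb \<le> k div n \<and> ?ji = k mod n then 1 else 0) + (if j = k then 1 else 0)"
        unfolding split_eq[of j k] by auto
      ultimately show ?thesis unfolding C_def Cb_def by (simp only: diff_conv_add_uminus) simp
    qed
    finally show ?thesis .
  qed
  have divC: "(\<Sum>i<N. mp_deriv i (C i k)) = 0" if "k < N" for k
  proof -
    have "mp_deriv i (C i k) = 0" if "i \<ge> n" for i
    proof -
      have "mp_deriv i (mp_deriv a (P r (i mod n))) = 0" for a r
        by (rule mp_deriv_outside[of _ "{..<n}"]) (use that P[OF md] in auto)
      then have "mp_deriv i (Q r (i mod n) (k mod n)) = 0" for r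
        using that by (simp add: Q_def mp_deriv_sum mp_deriv_mult out md)
      then show ?thesis by (simp add: C_def Cb_def mp_deriv_sum)
    qed
    then have "(\<Sum>i<N. mp_deriv i (C i k)) = (\<Sum>i<n. mp_deriv i (C i k))"
      using nN by (intro sum.mono_neutral_right) auto
    also have "\<dots> = 0" using div[OF md] by (simp add: C0)
    finally show ?thesis .
  qed
  have hom: "wt w m = w j + 1" if j: "j < N" and m: "m \<in> Poly_Mapping.keys (H j)" for j m
  proof -
    have "m \<in> Poly_Mapping.keys (P (j div n) (j mod n)) \<or> m = Poly_Mapping.single (j + n) 1"
      using m j Poly_Mapping.keys_add[of "P (j div n) (j mod n)" "mp_var (j + n)"]
      by (auto simp: H_def mp_var_def split: if_splits)
    then show ?thesis
    proof
      assume m: "m \<in> Poly_Mapping.keys (P (j div n) (j mod n))"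
      then have "Poly_Mapping.keys m \<subseteq> {..<n}" using P[OF md] by (auto simp: mp_ring_def)
      then have "wt w m = int (mono_deg m)"
        by (auto simp: wt_def mono_deg_def w_def subset_eq intro!: sum.cong)
      then show ?thesis using deg[OF md m] by (simp add: w_def)
    next
      assume "m = Poly_Mapping.single (j + n) 1"
      then show ?thesis by (simp add: wt_single w_def dvn)
    qed
  qed
  have H_ring: "H j \<in> mp_ring {..<N}" for j
    using mp_ring_mono[OF P[OF md], of "{..<N}"] nN by (auto simp: H_def)
  have w1: "w x \<ge> 1" for x by (simp add: w_def)
  have one: "ag_coeff H N m 1 = 0" if "m \<ge> 1" for m
    by (rule ag_coeff_one[of w N H C]) (use w1 H_ring hom inv divC that in auto)
  have zero_iff: "ag_coeff H N m g = 0 \<longleftrightarrow> ag_op H N m g = 0" for m g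
    by (auto simp: ag_coeff_def poly_mapping_eq_iff fun_eq_iff)
  have ev: "\<exists>M. \<forall>m\<ge>M. ag_coeff H N m g = 0" for g
    using mathieu_imp_ag_op_eventually_zero[OF mathieu, of N H g] H_ring one by (simp add: zero_iff)
  obtain G where G: "\<And>k. mp_subst (\<lambda>k. mp_var k - H k) (G k) = mp_var k"
    "\<And>k. mp_subst G (mp_var k - H k) = mp_var k"
    using polynomial_inverse_exists[of w N H] w1 hom one ev by (auto simp: H_def)

  show thesis
  proof (rule that[of G])
    fix x :: "nat \<Rightarrow> complex" and i assume i: "i < n"
    define y where "y k = (if k < n then x k else (\<Sum>r=k div n..<D. mp_value x (P r (k mod n))))" for k
    have yP: "mp_value y (P j a) = mp_value x (P j a)" if "a < n" for j a
      by (rule mp_value_cong[OF P[OF that]]) (simp add: y_def)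
    have "mp_value y (mp_var k - H k) = (if k < n then mp_value x (F k) else 0)" for k
    proof (cases "k < N")
      case False
      then have "\<not> k div n < D" using dv by simp
      then show ?thesis using False nN by (simp add: H_def y_def)
    next
      case True
      have next_y: "mp_value y (if k + n < N then mp_var (k + n) else 0) =
          (\<Sum>r=Suc (k div n)..<D. mp_value x (P r (k mod n)))"
        using dv[of "k + n"] by (auto simp: y_def dvn)
      have "(\<Sum>r=k div n..<D. mp_value x (P r (k mod n))) =
          mp_value x (P (k div n) (k mod n)) + (\<Sum>r=Suc (k div n)..<D. mp_value x (P r (k mod n)))"
        using dv[of k] True by (intro sum.atLeast_Suc_lessThan) simp
      then have "mp_value y (H k) = (\<Sum>r=k div n..<D. mp_value x (P r (k mod n)))"
        using True by (simp add: H_def value_hom.hom_add next_y yP md)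
      then show ?thesis
        by (auto simp: value_hom.hom_minus y_def F value_hom.hom_sum lessThan_atLeast0)
    qed
    then have "mp_value (\<lambda>k. if k < n then mp_value x (F k) else 0) (G i) =
        mp_value y (mp_subst (\<lambda>k. mp_var k - H k) (G i))"
      by (simp add: mp_value_subst)
    then show "mp_value (\<lambda>k. if k < n then mp_value x (F k) else 0) (G i) = x i"
      using i by (simp add: G y_def)
  next
    fix u :: "nat \<Rightarrow> complex" and i assume i: "i < n"
    define v where "v k = (if k < n then u k else 0)" for k
    define y where "y k = mp_value v (G k)" for k
    define Y where "Y j = (if j < D then y (j * n + i) else 0)" for j
    \<comment> \<open>Summed over \<open>j\<close>, the added variables telescope away.\<close>
    have step: "Y j - Y (Suc j) = mp_value y (P j i) + (if j = 0 then u i else 0)" if j: "j < D" for j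
    proof -
      let ?k = "j * n + i"
      have k: "?k div n = j" "?k mod n = i" using i by auto
      have kN: "?k < N" using dv[of ?k] j k by simp
      have next_k: "?k + n < N \<longleftrightarrow> Suc j < D" using dv[of "?k + n"] dvn k by simp
      have "v ?k = mp_value v (mp_subst G (mp_var ?k - H ?k))" by (simp add: G)
      also have "\<dots> = mp_value y (mp_var ?k - H ?k)" unfolding mp_value_subst y_def[abs_def] ..
      also have "\<dots> = y ?k - (mp_value y (P j i) + (if Suc j < D then y (?k + n) else 0))"
        using i unfolding value_hom.hom_minus by (simp add: H_def kN k next_k value_hom.hom_add)
      finally have "v ?k = y ?k - (mp_value y (P j i) + (if Suc j < D then y (?k + n) else 0))" .
      moreover have "v ?k = (if j = 0 then u i else 0)" using i n by (cases j) (auto simp: v_def)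
      ultimately show ?thesis using j by (auto simp: Y_def algebra_simps)
    qed
    have "Y 0 - Y D = (\<Sum>j<D. Y j - Y (Suc j))" by (simp add: sum_lessThan_telescope')
    also have "\<dots> = (\<Sum>j<D. mp_value y (P j i)) + u i"
      using D by (simp add: step sum.distrib)
    finally have "y i - (\<Sum>j<D. mp_value y (P j i)) = u i"
      using D by (simp add: Y_def)
    then show "mp_value (\<lambda>k. mp_value (\<lambda>k. if k < n then u k else 0) (G k)) (F i) = u i"
      unfolding y_def v_def F[OF i] by (simp add: value_hom.hom_minus value_hom.hom_sum)
  qed
qed

definition hom_part :: "nat \<Rightarrow> 'v mp \<Rightarrow> 'v mp" where
  "hom_part d p = Poly_Mapping.mapp (\<lambda>m c. c when mono_deg m = d) p"

lemma lookup_hom_part: "Poly_Mapping.lookup (hom_part d p) m = (Poly_Mapping.lookup p m when mono_deg m = d)"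
  by (simp add: hom_part_def lookup_mapp when_def in_keys_iff)

lemma hom_part_in_ring: "p \<in> mp_ring V \<Longrightarrow> hom_part d p \<in> mp_ring V"
  unfolding mp_ring_def by (fastforce simp: in_keys_iff lookup_hom_part when_def split: if_splits)

lemma lookup_0_eq_value: "Poly_Mapping.lookup p 0 = mp_value (\<lambda>_. 0) p"
  by (induction p rule: mp_induct)
     (simp_all add: lookup_add value_hom.hom_add value_hom.hom_mult lookup_var_mult,
      simp add: mp_const_def)

lemma low_degree_lookup:
  assumes "Poly_Mapping.lookup p 0 = 0" "\<And>x. Poly_Mapping.lookup (mp_deriv x p) 0 = 0"
    and "m \<in> Poly_Mapping.keys p"
  shows "mono_deg m \<ge> 2"
proof (rule ccontr)
  assume "\<not> mono_deg m \<ge> 2"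
  then have small: "mono_deg m \<le> 1" by simp
  have "m \<noteq> 0" using assms by (auto simp: in_keys_iff)
  then obtain x where x: "x \<in> Poly_Mapping.keys m"
    by (metis in_keys_iff lookup_zero poly_mapping_eqI)
  then have "mono_deg (m - Poly_Mapping.single x 1) = 0"
    using mono_deg_diff_single[of m x] small by (simp add: in_keys_iff)
  then have "m - Poly_Mapping.single x 1 = 0"
    by (auto simp: mono_deg_def in_keys_iff intro!: poly_mapping_eqI)
  moreover have "m - Poly_Mapping.single x 1 + Poly_Mapping.single x 1 = m"
    by (rule poly_mapping_eqI)
       (use x in \<open>auto simp: lookup_add lookup_minus lookup_single when_def in_keys_iff\<close>)
  ultimately have "0 + Poly_Mapping.single x 1 = m" by simp
  then have "Poly_Mapping.lookup (mp_deriv x p) 0 = Poly_Mapping.lookup p m"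
    by (simp add: lookup_mp_deriv del: One_nat_def)
  with assms(2)[of x] assms(3) show False by (simp add: in_keys_iff)
qed


section \<open>The Jacobian conjecture\<close>

text \<open>An affine change of coordinates in the target gives \<open>F\<close> value 0 and identity derivative at the
  origin.  The inverse of the derivative at the origin is the value \<open>\<kappa>\<close> there of the inverse
  Jacobian matrix \<open>K\<close>.\<close>

theorem corollary4p7:
  assumes "\<forall>n\<ge>1. \<forall>t::complex. mathieu_subspace complex_ring (B_alg n t) (xi_subspace n)"
  shows "jacobian_conjecture"
  unfolding jacobian_conjecture_def
proof (intro allI impI)
  fix n :: nat and F
  assume n: "n \<ge> 1"
    and "poly_tuple n F \<and> (\<exists>c. c \<noteq> 0 \<and> det (jacobian_matrix n F) = mp_const c)"
  then obtain c where F: "poly_tuple n F" and c: "c \<noteq> 0" "det (jacobian_matrix n F) = mp_const c"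
    by blast
  have F_ring: "F i \<in> mp_ring {..<n}" if "i < n" for i using F that by (simp add: poly_tuple_def)
  obtain K where
    MK: "\<And>j k. j < n \<Longrightarrow> k < n \<Longrightarrow> (\<Sum>i<n. mp_deriv i (F j) * K i k) = (if j = k then 1 else 0)" and
    KM: "\<And>i j. i < n \<Longrightarrow> j < n \<Longrightarrow> (\<Sum>a<n. K i a * mp_deriv j (F a)) = (if i = j then 1 else 0)" and
    div: "\<And>k. k < n \<Longrightarrow> (\<Sum>i<n. mp_deriv i (K i k)) = 0" and
    out: "\<And>x i k. i < n \<Longrightarrow> k < n \<Longrightarrow> x \<ge> n \<Longrightarrow> mp_deriv x (K i k) = 0"
    by (rule inverse_jacobian_divergence_free[OF F c(2,1)]) (rule that)
  define at0 :: "nat mp \<Rightarrow> complex" where "at0 = mp_value (\<lambda>_. 0)"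
  interpret at0: comm_ring_hom at0 unfolding at0_def by (rule value_hom.comm_ring_hom_axioms)
  define l where "l j k = at0 (mp_deriv k (F j))" for j k
  define \<kappa> where "\<kappa> i j = at0 (K i j)" for i j
  have l\<kappa>: "(\<Sum>i<n. l j i * \<kappa> i k) = (if j = k then 1 else 0)" if "j < n" "k < n" for j k
    using arg_cong[OF MK[OF that], of at0] by (simp add: l_def \<kappa>_def at0.hom_sum at0.hom_mult split: if_splits)
  have \<kappa>l: "(\<Sum>a<n. \<kappa> i a * l a j) = (if i = j then 1 else 0)" if "i < n" "j < n" for i j
    using arg_cong[OF KM[OF that], of at0] by (simp add: l_def \<kappa>_def at0.hom_sum at0.hom_mult split: if_splits)

  define Ft where "Ft i = (\<Sum>j<n. mp_const (\<kappa> i j) * (F j - mp_const (at0 (F j))))" for i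
  define Kt where "Kt i k = (\<Sum>j<n. mp_const (l j k) * K i j)" for i k
  define P where "P j i = hom_part (j + 2) (mp_var i - Ft i)" for j i
  have Ft_ring: "Ft i \<in> mp_ring {..<n}" for i
    unfolding Ft_def using F_ring by (auto intro!: mp_ring_sum mp_ring_mult mp_ring_diff)
  have dFt: "mp_deriv x (Ft i) = (\<Sum>j<n. mp_const (\<kappa> i j) * mp_deriv x (F j))" for x i
    by (simp add: Ft_def mp_deriv_sum)
  have low: "mono_deg m \<ge> 2" if i: "i < n" and m: "m \<in> Poly_Mapping.keys (mp_var i - Ft i)" for i m
  proof (rule low_degree_lookup[OF _ _ m])
    show "Poly_Mapping.lookup (mp_var i - Ft i) 0 = 0"
      unfolding lookup_0_eq_value at0_def[symmetric]
      by (simp add: at0.hom_minus Ft_def at0.hom_sum at0.hom_mult) (simp add: at0_def)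
    fix x
    have "at0 (mp_deriv x (mp_var i - Ft i)) = (if x = i then 1 else 0) - (\<Sum>j<n. \<kappa> i j * l j x)"
      by (simp add: dFt mp_deriv_var at0.hom_minus at0.hom_sum at0.hom_mult l_def) (simp add: at0_def)
    also have "\<dots> = 0"
    proof (cases "x < n")
      case False
      then have "l j x = 0" if "j < n" for j
        using mp_deriv_outside[OF F_ring[OF that], of x] by (simp add: l_def)
      then show ?thesis using i False by simp
    qed (use \<kappa>l[OF i] in auto)
    finally show "Poly_Mapping.lookup (mp_deriv x (mp_var i - Ft i)) 0 = 0"
      by (simp add: lookup_0_eq_value at0_def)
  qed
  define D where "D = Suc (\<Sum>i<n. \<Sum>m\<in>Poly_Mapping.keys (mp_var i - Ft i). mono_deg m)"
  have high: "mono_deg m < D" if "i < n" "m \<in> Poly_Mapping.keys (mp_var i - Ft i)" for i m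
  proof -
    have "mono_deg m \<le> (\<Sum>m\<in>Poly_Mapping.keys (mp_var i - Ft i). mono_deg m)"
      using that by (intro member_le_sum) auto
    also have "\<dots> \<le> (\<Sum>i<n. \<Sum>m\<in>Poly_Mapping.keys (mp_var i - Ft i). mono_deg m)"
      using that(1) by (intro member_le_sum[of i]) auto
    finally show ?thesis by (simp add: D_def)
  qed
  have Ft_eq: "Ft i = mp_var i - (\<Sum>j<D. P j i)" if i: "i < n" for i
  proof -
    have "(\<Sum>j<D. P j i) = mp_var i - Ft i"
    proof (rule poly_mapping_eqI)
      fix m
      have "Poly_Mapping.lookup (\<Sum>j<D. P j i) m =
          (\<Sum>j<D. if j + 2 = mono_deg m then Poly_Mapping.lookup (mp_var i - Ft i) m else 0)"
        unfolding P_def lookup_sum lookup_hom_part when_def by (rule sum.cong) auto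
      also have "\<dots> = Poly_Mapping.lookup (mp_var i - Ft i) m"
      proof (cases "m \<in> Poly_Mapping.keys (mp_var i - Ft i)")
        case True
        with low[OF i] high[OF i] obtain d where d: "mono_deg m = d + 2" "d < D"
          by (metis add.commute le_Suc_ex less_trans add_lessD1)
        then show ?thesis by simp
      qed (auto simp: in_keys_iff intro!: sum.neutral)
      finally show "Poly_Mapping.lookup (\<Sum>j<D. P j i) m = Poly_Mapping.lookup (mp_var i - Ft i) m" .
    qed
    then show ?thesis by simp
  qed
  obtain G where
    G1: "\<And>x i. i < n \<Longrightarrow> mp_value (\<lambda>k. if k < n then mp_value x (Ft k) else 0) (G i) = x i" and
    G2: "\<And>u i. i < n \<Longrightarrow> mp_value (\<lambda>k. mp_value (\<lambda>k. if k < n then u k else 0) (G k)) (Ft i) = u i"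
  proof (rule normalized_inverse[OF assms n, of D Ft P Kt])
    show "D \<ge> 1" by (simp add: D_def)
    show "Ft i = mp_var i - (\<Sum>j<D. P j i)" if "i < n" for i by (rule Ft_eq[OF that])
    show "P j i \<in> mp_ring {..<n}" if "i < n" for j i
      unfolding P_def using that Ft_ring by (intro hom_part_in_ring) simp
    show "mono_deg m = j + 2" if "i < n" "m \<in> Poly_Mapping.keys (P j i)" for j i m
      using that(2) by (simp add: P_def in_keys_iff lookup_hom_part when_def split: if_splits)
    show "(\<Sum>i<n. mp_deriv i (Ft j) * Kt i k) = (if j = k then 1 else 0)" if jk: "j < n" "k < n" for j k
    proof -
      have "(\<Sum>i<n. mp_deriv i (Ft j) * Kt i k) =
          (\<Sum>i<n. \<Sum>a<n. \<Sum>b<n. mp_const (\<kappa> j a * l b k) * (mp_deriv i (F a) * K i b))"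
        unfolding dFt Kt_def sum_product by (simp add: mp_const.hom_mult mult_ac)
      also have "\<dots> = (\<Sum>a<n. \<Sum>i<n. \<Sum>b<n. mp_const (\<kappa> j a * l b k) * (mp_deriv i (F a) * K i b))"
        by (rule sum.swap)
      also have "\<dots> = (\<Sum>a<n. \<Sum>b<n. \<Sum>i<n. mp_const (\<kappa> j a * l b k) * (mp_deriv i (F a) * K i b))"
        by (rule sum.cong[OF refl]) (rule sum.swap)
      also have "\<dots> = (\<Sum>a<n. \<Sum>b<n. mp_const (\<kappa> j a * l b k) * (if a = b then 1 else 0))"
        by (intro sum.cong refl) (simp add: MK flip: sum_distrib_left)
      also have "\<dots> = mp_const (\<Sum>a<n. \<kappa> j a * l a k)"
        by (simp add: if_distrib mp_const.hom_sum cong: if_cong)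
      finally show ?thesis using \<kappa>l[OF jk] by simp
    qed
    show "(\<Sum>i<n. mp_deriv i (Kt i k)) = 0" for k
    proof -
      have "(\<Sum>i<n. mp_deriv i (Kt i k)) = (\<Sum>j<n. mp_const (l j k) * (\<Sum>i<n. mp_deriv i (K i j)))"
        unfolding Kt_def mp_deriv_sum sum_distrib_left by (subst sum.swap) simp
      then show ?thesis by (simp add: div)
    qed
    show "mp_deriv x (Kt i k) = 0" if "i < n" "x \<ge> n" for x i k
      using that by (simp add: Kt_def mp_deriv_sum out)
  qed (use n in auto)

  define U where "U k = (\<Sum>j<n. mp_const (\<kappa> k j) * (mp_var j - mp_const (at0 (F j))))" for k
  define \<Gamma> where "\<Gamma> i = mp_subst (\<lambda>k. if k < n then U k else 0) (G i)" for i
  have \<Gamma>: "poly_tuple n \<Gamma>"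
  proof -
    have "U k \<in> mp_ring {..<n}" for k
      unfolding U_def by (auto intro!: mp_ring_sum mp_ring_mult mp_ring_diff)
    then show ?thesis
      unfolding poly_tuple_def \<Gamma>_def by (auto intro: mp_subst_in_ring[of _ UNIV])
  qed
  have value_\<Gamma>: "mp_value u (\<Gamma> i) = mp_value (\<lambda>k. if k < n then
      \<Sum>j<n. \<kappa> k j * (u j - at0 (F j)) else 0) (G i)" for u i
    unfolding \<Gamma>_def mp_value_subst
    by (intro arg_cong2[of _ _ _ _ mp_value] ext)
       (auto simp: U_def value_hom.hom_sum value_hom.hom_mult value_hom.hom_minus)
  have value_Ft: "mp_value x (Ft k) = (\<Sum>j<n. \<kappa> k j * (mp_value x (F j) - at0 (F j)))" for x k
    by (simp add: Ft_def value_hom.hom_sum value_hom.hom_mult value_hom.hom_minus)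
  show "\<exists>G. poly_tuple n G \<and> (\<forall>x\<in>carrier_vec n. poly_map n G (poly_map n F x) = x \<and>
      poly_map n F (poly_map n G x) = x)"
  proof (intro exI[of _ \<Gamma>] conjI ballI \<Gamma>)
    fix x :: "complex vec" assume x: "x \<in> carrier_vec n"
    show "poly_map n \<Gamma> (poly_map n F x) = x"
    proof (rule eq_vecI)
      fix i assume "i < dim_vec x"
      then have i: "i < n" using x by simp
      have "(poly_map n \<Gamma> (poly_map n F x)) $ i =
          mp_value (\<lambda>k. if k < n then mp_value (\<lambda>j. x $ j) (Ft k) else 0) (G i)"
        using i by (simp add: poly_map_def value_\<Gamma> value_Ft cong: if_cong)
      then show "(poly_map n \<Gamma> (poly_map n F x)) $ i = x $ i" using G1[OF i] by simp
    qed (use x in \<open>simp add: poly_map_def\<close>)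
    show "poly_map n F (poly_map n \<Gamma> x) = x"
    proof (rule eq_vecI)
      fix i assume "i < dim_vec x"
      then have i: "i < n" using x by simp
      define y where "y k = mp_value (\<lambda>j. x $ j) (\<Gamma> k)" for k
      have Fty: "mp_value y (Ft a) = (\<Sum>j<n. \<kappa> a j * (x $ j - at0 (F j)))" if "a < n" for a
        unfolding y_def value_\<Gamma> using that by (rule G2)
      have invert: "s i = (\<Sum>a<n. l i a * (\<Sum>j<n. \<kappa> a j * s j))" for s :: "nat \<Rightarrow> complex"
      proof -
        have "(\<Sum>a<n. l i a * (\<Sum>j<n. \<kappa> a j * s j)) = (\<Sum>j<n. (\<Sum>a<n. l i a * \<kappa> a j) * s j)"
          unfolding sum_distrib_left sum_distrib_right by (subst sum.swap) (simp add: mult.assoc)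
        also have "\<dots> = (\<Sum>j<n. if j = i then s j else 0)"
          by (rule sum.cong) (use l\<kappa>[OF i] in auto)
        finally show ?thesis using i by simp
      qed
      have "mp_value y (F i) - at0 (F i) = x $ i - at0 (F i)"
        using invert[of "\<lambda>j. mp_value y (F j) - at0 (F j)"] invert[of "\<lambda>j. x $ j - at0 (F j)"]
        by (simp add: Fty flip: value_Ft)
      moreover have "(poly_map n F (poly_map n \<Gamma> x)) $ i = mp_value y (F i)"
        using i mp_value_cong[OF F_ring[OF i], of "\<lambda>j. poly_map n \<Gamma> x $ j" y]
        by (simp add: poly_map_def y_def)
      ultimately show "(poly_map n F (poly_map n \<Gamma> x)) $ i = x $ i" by simp
    qed (use x in \<open>simp add: poly_map_def\<close>)
  qed
qed

end
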